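(* Let $\rho$ be a continuous monotonically increasing real-valued function on $[a,b]$ whose Lebesgue-Stieltjes measure is equivalent to Lebesgue measure on $[a,b]$. Let $\{\phi_n: n\ge1\}$ be an orthonormal basis for $L^2_\rho[a,b]$ and let $\{\xi_n: n\ge1\}$ be an independent sequence of standard Gaussian random variables on a probability space $\Omega$. Then the random series $$\widetilde X(t)=\sum_{n=1}^\infty\bigg(\int_a^t\phi_n(s)\,d\rho(s)\bigg)\xi_n,\qquad a\le t\le b,$$ converges in $L^2(\Omega)$ and almost surely, and the stochastic process $\widetilde X(t)$ is a Yeh process with mean function $0$ and variance function $\rho(t)$. If, in addition, $\lambda$ is a continuous real-valued function of bounded variation on $[a,b]$, then $$X(t)=\lambda(t)+\sum_{n=1}^\infty\bigg(\int_a^t\phi_n(s)\,d\rho(s)\bigg)\xi_n,\qquad a\le t\le b,$$ is a Yeh process with mean function $\lambda(t)$ and variance function $\rho(t)$.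
   Context: $[a,b]\subset[0,\infty)$ is a finite interval. $L^2_\rho[a,b]$ is the Hilbert space of real functions $f$ on $[a,b]$ with $\int_a^b|f|^2\,d\rho<\infty$ (Lebesgue-Stieltjes integral), with inner product $\langle f,g\rangle_\rho=\int_a^b fg\,d\rho$. Two measures are equivalent if they are mutually absolutely continuous. A Yeh process with mean function $\lambda$ and variance function $\rho$ (that is, associated with the functions $\lambda$ and $\rho$) is a continuous real-valued stochastic process $X(t)$, $t\in[a,b]$, that is additive (has independent increments) and satisfies, for all $a\le s<t\le b$, $X(t)-X(s)\sim N(\lambda(t)-\lambda(s),\rho(t)-\rho(s))$; here $N(\mu,\sigma^2)$ is the normal distribution with mean $\mu$ and variance $\sigma^2$. *)

theory Defs
  imports "HOL-Probability.Probability"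
begin

(* interval_measure expects a function on the whole line, so rho is extended by its end
   values. The completion is taken because a Lebesgue-Stieltjes measure is complete. *)
definition stieltjes_measure :: "real \<Rightarrow> real \<Rightarrow> (real \<Rightarrow> real) \<Rightarrow> real measure" where
  "stieltjes_measure a b \<rho> =
     restrict_space (completion (interval_measure (\<lambda>x. \<rho> (max a (min x b))))) {a..b}"

definition equivalent_measures :: "'a measure \<Rightarrow> 'a measure \<Rightarrow> bool" where
  "equivalent_measures M N \<longleftrightarrow> absolutely_continuous M N \<and> absolutely_continuous N M"

definition L2_functions :: "'a measure \<Rightarrow> ('a \<Rightarrow> real) set" where
  "L2_functions M = {f \<in> borel_measurable M. integrable M (\<lambda>x. (f x)\<^sup>2)}"

definition L2_inner :: "'a measure \<Rightarrow> ('a \<Rightarrow> real) \<Rightarrow> ('a \<Rightarrow> real) \<Rightarrow> real" where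
  "L2_inner M f g = (LINT x|M. f x * g x)"

definition L2_norm :: "'a measure \<Rightarrow> ('a \<Rightarrow> real) \<Rightarrow> real" where
  "L2_norm M f = sqrt (L2_inner M f f)"

definition L2_tendsto :: "'a measure \<Rightarrow> (nat \<Rightarrow> 'a \<Rightarrow> real) \<Rightarrow> ('a \<Rightarrow> real) \<Rightarrow> bool" where
  "L2_tendsto M f g \<longleftrightarrow>
     (\<forall>n. f n \<in> L2_functions M) \<and> g \<in> L2_functions M \<and>
     (\<lambda>n. L2_norm M (\<lambda>x. f n x - g x)) \<longlonglongrightarrow> 0"

definition L2_orthonormal_basis :: "'a measure \<Rightarrow> (nat \<Rightarrow> 'a \<Rightarrow> real) \<Rightarrow> bool" where
  "L2_orthonormal_basis M \<phi> \<longleftrightarrow>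
     (\<forall>n. \<phi> n \<in> L2_functions M) \<and>
     (\<forall>m n. L2_inner M (\<phi> m) (\<phi> n) = (if m = n then 1 else 0)) \<and>
     (\<forall>f \<in> L2_functions M. \<forall>\<epsilon>>0. \<exists>N (c :: nat \<Rightarrow> real).
        L2_norm M (\<lambda>x. f x - (\<Sum>n<N. c n * \<phi> n x)) < \<epsilon>)"

definition bounded_variation_on :: "real \<Rightarrow> real \<Rightarrow> (real \<Rightarrow> real) \<Rightarrow> bool" where
  "bounded_variation_on a b f \<longleftrightarrow>
     (\<exists>B. \<forall>(n::nat) \<tau>. (\<forall>i\<le>n. \<tau> i \<in> {a..b}) \<and> (\<forall>i<n. \<tau> i < \<tau> (Suc i)) \<longrightarrow>
        (\<Sum>i<n. \<bar>f (\<tau> (Suc i)) - f (\<tau> i)\<bar>) \<le> B)"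

(* The normal law with mean mu and variance v; the case distinction is needed because
   normal_density takes the standard deviation and is identically 0 when that is 0. *)
definition normal_law :: "real \<Rightarrow> real \<Rightarrow> real measure" where
  "normal_law \<mu> v =
     (if v = 0 then return borel \<mu>
      else density lborel (\<lambda>x. ennreal (normal_density \<mu> (sqrt v) x)))"

definition independent_increments ::
    "'w measure \<Rightarrow> real \<Rightarrow> real \<Rightarrow> (real \<Rightarrow> 'w \<Rightarrow> real) \<Rightarrow> bool" where
  "independent_increments M a b X \<longleftrightarrow>
     (\<forall>(n::nat) \<tau>. (\<forall>i\<le>n. \<tau> i \<in> {a..b}) \<and> (\<forall>i<n. \<tau> i < \<tau> (Suc i)) \<longrightarrow>
        prob_space.indep_vars M (\<lambda>_. borel) (\<lambda>i \<omega>. X (\<tau> (Suc i)) \<omega> - X (\<tau> i) \<omega>) {..<n})"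

(* Continuity of a process means that almost every sample path is continuous. *)
definition yeh_process ::
    "'w measure \<Rightarrow> real \<Rightarrow> real \<Rightarrow> (real \<Rightarrow> real) \<Rightarrow> (real \<Rightarrow> real) \<Rightarrow> (real \<Rightarrow> 'w \<Rightarrow> real) \<Rightarrow> bool" where
  "yeh_process M a b m \<rho> X \<longleftrightarrow>
     (\<forall>t\<in>{a..b}. X t \<in> borel_measurable M) \<and>
     (AE \<omega> in M. continuous_on {a..b} (\<lambda>t. X t \<omega>)) \<and>
     independent_increments M a b X \<and>
     (\<forall>s t. a \<le> s \<and> s < t \<and> t \<le> b \<longrightarrow>
        distr M borel (\<lambda>\<omega>. X t \<omega> - X s \<omega>) = normal_law (m t - m s) (\<rho> t - \<rho> s))"

definition stieltjes_primitive ::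
    "real \<Rightarrow> real \<Rightarrow> (real \<Rightarrow> real) \<Rightarrow> (real \<Rightarrow> real) \<Rightarrow> real \<Rightarrow> real" where
  "stieltjes_primitive a b \<rho> f t = (LINT s:{a..t}|stieltjes_measure a b \<rho>. f s)"

end

theory Submission
  imports Defs
begin

text \<open>
  Write \<open>c\<^sub>n(t)\<close> for the integral of \<open>\<phi>\<^sub>n\<close> over \<open>{a..t}\<close>. Since \<open>c\<^sub>n(t) - c\<^sub>n(s)\<close> is the inner product
  of \<open>\<phi>\<^sub>n\<close> with the indicator of \<open>{s<..t}\<close>, Parseval's identity turns every statement about
  variances of the series into one about \<open>\<rho>\<close>: the squares of \<open>c\<^sub>n(t) - c\<^sub>n(s)\<close> sum to
  \<open>\<rho> t - \<rho> s\<close>, and for increments over disjoint intervals, weighted by \<open>u\<^sub>i\<close>, to the sum of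
  \<open>u\<^sub>i\<^sup>2 (\<rho> t\<^sub>i - \<rho> s\<^sub>i)\<close> (lemma \<open>combination_sums\<close>).

  The laws then follow by characteristic functions. A convergent series of independent standard
  Gaussians with square-summable coefficients is a centred normal variable whose variance is the
  sum of the squares (\<open>distr_series\<close>), so a linear combination of increments over
  disjoint intervals has a characteristic function that splits into the product of those of the
  increments. This factorization implies independence (\<open>indep_vars_char\<close>).

  The difficult point is that the exceptional null set must not depend on \<open>t\<close>, that is, the
  series must almost surely converge uniformly on \<open>{a..b}\<close>; this also gives continuity of the
  paths. The time change \<open>u = (\<rho> t - \<rho> a) / (\<rho> b - \<rho> a)\<close> reduces this to coefficient functions on
  \<open>{0..1}\<close> for which the squares of the increments sum to a multiple of \<open>\<bar>u - v\<bar>\<close>. There Kolmogorov's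
  chaining argument is applied to all blocks of the series at once. A Gaussian sum has
  fourth moment three times the square of its variance, so by a maximal inequality for the partial
  sums (\<open>maximal_inequality\<close>) the probability that some block of the series after index \<open>m\<close> has an
  increment of size \<open>\<epsilon> q\<^sup>j\<close> over some dyadic interval of level \<open>j\<close> is at most a constant times
  \<open>(2 q\<^sup>4)\<^sup>-\<^sup>j\<close>, which is summable in \<open>j\<close>
  for \<open>q = 9/10\<close>. For each fixed \<open>j\<close> the bound tends to 0 as \<open>m\<close> grows, because the tails of the
  convergent series of squares do; by dominated convergence so does the sum over \<open>j\<close>. Off a small
  event, therefore, every block after \<open>m\<close> is uniformly bounded by the sum of the \<open>\<epsilon> q\<^sup>j\<close>
  (\<open>dyadic_chaining\<close>), and the series is uniformly Cauchy.
\<close>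

section \<open>Parseval's identity\<close>

lemma L2_mult_integrable:
  assumes "f \<in> L2_functions N" "g \<in> L2_functions N"
  shows "integrable N (\<lambda>x. f x * g x)"
proof (rule Bochner_Integration.integrable_bound)
  show "integrable N (\<lambda>x. (f x)\<^sup>2 + (g x)\<^sup>2)"
    using assms by (auto simp: L2_functions_def)
  show "(\<lambda>x. f x * g x) \<in> borel_measurable N"
    using assms by (auto simp: L2_functions_def)
  show "AE x in N. norm (f x * g x) \<le> norm ((f x)\<^sup>2 + (g x)\<^sup>2)"
  proof (rule AE_I2)
    fix x
    have "0 \<le> (\<bar>f x\<bar> - \<bar>g x\<bar>)\<^sup>2" "0 \<le> \<bar>f x\<bar> * \<bar>g x\<bar>"
      by simp_all
    then have "\<bar>f x\<bar> * \<bar>g x\<bar> \<le> (f x)\<^sup>2 + (g x)\<^sup>2"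
      unfolding power2_diff power2_abs by linarith
    then show "norm (f x * g x) \<le> norm ((f x)\<^sup>2 + (g x)\<^sup>2)"
      by (simp add: abs_mult)
  qed
qed

lemma L2_scale_add:
  assumes "f \<in> L2_functions N" "g \<in> L2_functions N"
  shows "(\<lambda>x. f x + c * g x) \<in> L2_functions N"
proof -
  have [measurable]: "f \<in> borel_measurable N" "g \<in> borel_measurable N"
    using assms by (auto simp: L2_functions_def)
  have "integrable N (\<lambda>x. (f x)\<^sup>2 + (2 * c) * (f x * g x) + c\<^sup>2 * (g x)\<^sup>2)"
    using assms L2_mult_integrable[OF assms] by (auto simp: L2_functions_def)
  also have "(\<lambda>x. (f x)\<^sup>2 + (2 * c) * (f x * g x) + c\<^sup>2 * (g x)\<^sup>2) = (\<lambda>x. (f x + c * g x)\<^sup>2)"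
    by (auto simp: power2_eq_square algebra_simps)
  finally show ?thesis by (simp add: L2_functions_def)
qed

lemma L2_zero: "(\<lambda>x. 0) \<in> L2_functions N"
  by (simp add: L2_functions_def)

lemma L2_sum:
  assumes "\<And>i. i \<in> I \<Longrightarrow> h i \<in> L2_functions N"
  shows "(\<lambda>x. \<Sum>i\<in>I. u i * h i x) \<in> L2_functions N"
  using assms
proof (induction I rule: infinite_finite_induct)
  case (insert i I)
  then have "(\<lambda>x. (\<Sum>i\<in>I. u i * h i x) + u i * h i x) \<in> L2_functions N"
    by (intro L2_scale_add) auto
  with insert show ?case by (simp add: add.commute)
qed (simp_all add: L2_zero)

lemma L2_inner_sum_right:
  assumes "f \<in> L2_functions N" "\<And>i. i \<in> I \<Longrightarrow> h i \<in> L2_functions N"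
  shows "L2_inner N f (\<lambda>x. \<Sum>i\<in>I. u i * h i x) = (\<Sum>i\<in>I. u i * L2_inner N f (h i))"
proof -
  have "L2_inner N f (\<lambda>x. \<Sum>i\<in>I. u i * h i x) = (LINT x|N. (\<Sum>i\<in>I. u i * (f x * h i x)))"
    unfolding L2_inner_def by (intro arg_cong[where f="integral\<^sup>L N"] ext)
      (simp add: sum_distrib_left algebra_simps)
  also have "\<dots> = (\<Sum>i\<in>I. u i * L2_inner N f (h i))"
    using assms by (subst Bochner_Integration.integral_sum)
      (auto simp: L2_inner_def intro: L2_mult_integrable)
  finally show ?thesis .
qed

lemma L2_inner_commute: "L2_inner N f g = L2_inner N g f"
  by (simp add: L2_inner_def mult.commute)

lemma L2_inner_sum_both:
  assumes "finite I" "\<And>i. i \<in> I \<Longrightarrow> h i \<in> L2_functions N"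
    and orth: "\<And>i j. i \<in> I \<Longrightarrow> j \<in> I \<Longrightarrow> i \<noteq> j \<Longrightarrow> L2_inner N (h i) (h j) = 0"
  shows "L2_inner N (\<lambda>x. \<Sum>i\<in>I. u i * h i x) (\<lambda>x. \<Sum>i\<in>I. u i * h i x)
    = (\<Sum>i\<in>I. (u i)\<^sup>2 * L2_inner N (h i) (h i))"
proof -
  have "L2_inner N (\<lambda>x. \<Sum>i\<in>I. u i * h i x) (\<lambda>x. \<Sum>i\<in>I. u i * h i x)
      = (\<Sum>i\<in>I. u i * L2_inner N (h i) (\<lambda>x. \<Sum>i\<in>I. u i * h i x))"
    using assms by (subst L2_inner_sum_right) (auto intro!: L2_sum sum.cong L2_inner_commute)
  also have "\<dots> = (\<Sum>i\<in>I. (u i)\<^sup>2 * L2_inner N (h i) (h i))"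
  proof (rule sum.cong[OF refl])
    fix i assume i: "i \<in> I"
    have "L2_inner N (h i) (\<lambda>x. \<Sum>i\<in>I. u i * h i x) = (\<Sum>j\<in>I. u j * L2_inner N (h i) (h j))"
      using assms i by (subst L2_inner_sum_right) auto
    also have "\<dots> = (\<Sum>j\<in>I. if j = i then u i * L2_inner N (h i) (h i) else 0)"
      using orth i by (intro sum.cong) auto
    also have "\<dots> = u i * L2_inner N (h i) (h i)"
      using i \<open>finite I\<close> by simp
    finally show "u i * L2_inner N (h i) (\<lambda>x. \<Sum>i\<in>I. u i * h i x) = (u i)\<^sup>2 * L2_inner N (h i) (h i)"
      by (simp add: power2_eq_square)
  qed
  finally show ?thesis .
qed

text \<open>
  Completing the square. With \<open>c\<close> the Fourier coefficients it gives Bessel's inequality, and in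
  general it shows that no other choice of \<open>c\<close> approximates \<open>f\<close> better.
\<close>

lemma orthonormal_residual:
  fixes K :: nat
  assumes f: "f \<in> L2_functions N" and h: "\<And>n. \<phi> n \<in> L2_functions N"
    and orth: "\<And>m n. L2_inner N (\<phi> m) (\<phi> n) = (if m = n then 1 else 0)"
  shows "L2_inner N (\<lambda>x. f x - (\<Sum>n<K. c n * \<phi> n x)) (\<lambda>x. f x - (\<Sum>n<K. c n * \<phi> n x))
    = L2_inner N f f - (\<Sum>n<K. (L2_inner N (\<phi> n) f)\<^sup>2) + (\<Sum>n<K. (c n - L2_inner N (\<phi> n) f)\<^sup>2)"
proof -
  define g where "g = (\<lambda>x. \<Sum>n<K. c n * \<phi> n x)"
  have g: "g \<in> L2_functions N"
    unfolding g_def by (rule L2_sum) (rule h)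
  have fg: "L2_inner N f g = (\<Sum>n<K. c n * L2_inner N (\<phi> n) f)"
    unfolding g_def by (subst L2_inner_sum_right) (auto simp: f h L2_inner_commute)
  have gg: "L2_inner N g g = (\<Sum>n<K. (c n)\<^sup>2)"
    unfolding g_def using L2_inner_sum_both[of "{..<K}" \<phi> N c] by (simp add: h orth)
  have "L2_inner N (\<lambda>x. f x - g x) (\<lambda>x. f x - g x)
      = (LINT x|N. f x * f x - 2 * (f x * g x) + g x * g x)"
    unfolding L2_inner_def by (intro arg_cong[where f="integral\<^sup>L N"] ext) (simp add: algebra_simps)
  also have "\<dots> = L2_inner N f f - 2 * L2_inner N f g + L2_inner N g g"
    using L2_mult_integrable[OF f f] L2_mult_integrable[OF f g] L2_mult_integrable[OF g g]
    by (simp add: L2_inner_def)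
  also have "\<dots> = L2_inner N f f - (\<Sum>n<K. (L2_inner N (\<phi> n) f)\<^sup>2)
      + (\<Sum>n<K. (c n - L2_inner N (\<phi> n) f)\<^sup>2)"
    unfolding fg gg by (simp add: power2_diff sum.distrib sum_subtractf sum_distrib_left algebra_simps)
  finally show ?thesis unfolding g_def .
qed

lemma L2_inner_self_nonneg: "0 \<le> L2_inner N f f"
  by (simp add: L2_inner_def)

lemma parseval:
  assumes f: "f \<in> L2_functions N" and basis: "L2_orthonormal_basis N \<phi>"
  shows "(\<lambda>n. (L2_inner N (\<phi> n) f)\<^sup>2) sums L2_inner N f f"
proof -
  let ?s = "\<lambda>K. \<Sum>n<K. (L2_inner N (\<phi> n) f)\<^sup>2"
  have h: "\<And>n. \<phi> n \<in> L2_functions N"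
    and orth: "\<And>m n. L2_inner N (\<phi> m) (\<phi> n) = (if m = n then 1 else 0)"
    and dense: "\<And>\<epsilon>. \<epsilon> > 0 \<Longrightarrow> \<exists>K (c :: nat \<Rightarrow> real). L2_norm N (\<lambda>x. f x - (\<Sum>n<K. c n * \<phi> n x)) < \<epsilon>"
    using basis f unfolding L2_orthonormal_basis_def by blast+
  note res = orthonormal_residual[OF f h orth]
  have bessel: "?s K \<le> L2_inner N f f" for K
    using res[where K=K and c="\<lambda>n. L2_inner N (\<phi> n) f"] L2_inner_self_nonneg[of N "\<lambda>x. f x - (\<Sum>n<K. L2_inner N (\<phi> n) f * \<phi> n x)"]
    by simp
  show ?thesis
    unfolding sums_def
  proof (rule LIMSEQ_I)
    fix e :: real assume e: "e > 0"
    then obtain K c where K: "L2_norm N (\<lambda>x. f x - (\<Sum>n<K. c n * \<phi> n x)) < sqrt e"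
      using dense[of "sqrt e"] by auto
    then have "L2_inner N (\<lambda>x. f x - (\<Sum>n<K. c n * \<phi> n x)) (\<lambda>x. f x - (\<Sum>n<K. c n * \<phi> n x)) < e"
      by (simp add: L2_norm_def)
    then have "L2_inner N f f - ?s K < e"
      unfolding res using sum_nonneg[of "{..<K}" "\<lambda>n. (c n - L2_inner N (\<phi> n) f)\<^sup>2"] by simp
    moreover have "?s K \<le> ?s n" if "n \<ge> K" for n
      using that by (intro sum_mono2) auto
    ultimately have "norm (?s n - L2_inner N f f) < e" if "n \<ge> K" for n
      using bessel[of n] that e by (fastforce simp: abs_if)
    then show "\<exists>no. \<forall>n\<ge>no. norm (?s n - L2_inner N f f) < e"
      by blast
  qed
qed

section \<open>The Lebesgue-Stieltjes measure of a continuous monotone function\<close>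

text \<open>
  Continuity of \<open>\<rho>\<close> makes points null, which is why the closed interval carries no extra mass.
\<close>

lemma emeasure_stieltjes_interval:
  assumes cont: "continuous_on {a..b} \<rho>" and mono: "mono_on {a..b} \<rho>"
    and st: "a \<le> s" "s \<le> t" "t \<le> b"
  shows "{s..t} \<in> sets (stieltjes_measure a b \<rho>)"
    and "emeasure (stieltjes_measure a b \<rho>) {s..t} = ennreal (\<rho> t - \<rho> s)"
proof -
  let ?g = "\<lambda>x. \<rho> (max a (min x b))"
  let ?F = "interval_measure ?g"
  have mg: "?g x \<le> ?g y" if "x \<le> y" for x y
    using that st by (intro monotone_onD[OF mono]) (auto simp: max_def min_def)
  have cg: "continuous_on UNIV ?g"
    using st by (intro continuous_on_compose2[OF cont] continuous_intros) auto
  have m: "{s..t} \<in> sets ?F" "{a..b} \<in> sets (completion ?F)" by simp_all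
  then show "{s..t} \<in> sets (stieltjes_measure a b \<rho>)"
    unfolding stieltjes_measure_def using st
    by (subst sets_restrict_space_iff) auto
  have "emeasure (stieltjes_measure a b \<rho>) {s..t} = emeasure (completion ?F) {s..t}"
    unfolding stieltjes_measure_def using st by (subst emeasure_restrict_space) auto
  also have "\<dots> = emeasure ?F {s..t}"
    using m by simp
  also have "\<dots> = ennreal (?g t - ?g s)"
    using emeasure_interval_measure_Icc[OF st(2) mg cg] by simp
  finally show "emeasure (stieltjes_measure a b \<rho>) {s..t} = ennreal (\<rho> t - \<rho> s)"
    using st by (simp add: max_def min_def split: if_splits)
qed

lemma indicator_L2:
  assumes "A \<in> sets N" "emeasure N A < \<infinity>"
  shows "indicator A \<in> L2_functions N"
proof -
  have "(\<lambda>x. (indicator A x :: real)\<^sup>2) = indicator A"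
    by (auto simp: indicator_def)
  then show ?thesis using assms by (simp add: L2_functions_def)
qed

lemma stieltjes_indicator:
  assumes cont: "continuous_on {a..b} \<rho>" and mono: "mono_on {a..b} \<rho>"
    and st: "a \<le> s" "s \<le> t" "t \<le> b"
  shows "indicator {s<..t} \<in> L2_functions (stieltjes_measure a b \<rho>)"
    and "L2_inner (stieltjes_measure a b \<rho>) (indicator {s<..t}) (indicator {s<..t}) = \<rho> t - \<rho> s"
    and "f \<in> L2_functions (stieltjes_measure a b \<rho>) \<Longrightarrow>
      L2_inner (stieltjes_measure a b \<rho>) f (indicator {s<..t})
        = stieltjes_primitive a b \<rho> f t - stieltjes_primitive a b \<rho> f s"
proof -
  let ?\<mu> = "stieltjes_measure a b \<rho>"
  note I = emeasure_stieltjes_interval[OF cont mono]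
  have eq: "{s<..t} = {s..t} - {s..s}" by auto
  have sets: "{s<..t} \<in> sets ?\<mu>"
    unfolding eq by (intro sets.Diff I) (use st in auto)
  have em: "emeasure ?\<mu> {s<..t} = ennreal (\<rho> t - \<rho> s)"
    unfolding eq using I[of s t] I[of s s] st by (subst emeasure_Diff) auto
  show L: "indicator {s<..t} \<in> L2_functions ?\<mu>"
    using sets em by (intro indicator_L2) auto
  have "L2_inner ?\<mu> (indicator {s<..t}) (indicator {s<..t}) = (LINT x|?\<mu>. indicator {s<..t} x)"
    unfolding L2_inner_def by (intro arg_cong[where f="integral\<^sup>L ?\<mu>"] ext) (auto simp: indicator_def)
  also have "\<dots> = measure ?\<mu> {s<..t}"
    using sets em by (simp add: sets.sets_into_space Int_absorb2)
  also have "\<dots> = \<rho> t - \<rho> s"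
    using em st monotone_onD[OF mono, of s t] by (simp add: measure_def)
  finally show "L2_inner ?\<mu> (indicator {s<..t}) (indicator {s<..t}) = \<rho> t - \<rho> s" .
  assume f: "f \<in> L2_functions ?\<mu>"
  have i: "integrable ?\<mu> (\<lambda>x. f x * indicator {a..r} x)" if "a \<le> r" "r \<le> b" for r
    using that I[of a r] by (intro L2_mult_integrable f indicator_L2) auto
  have "stieltjes_primitive a b \<rho> f t - stieltjes_primitive a b \<rho> f s
      = (LINT x|?\<mu>. f x * indicator {a..t} x - f x * indicator {a..s} x)"
    unfolding stieltjes_primitive_def set_lebesgue_integral_def
    using i[of t] i[of s] st by (simp add: mult.commute)
  also have "(\<lambda>x. f x * indicator {a..t} x - f x * indicator {a..s} x) = (\<lambda>x. f x * indicator {s<..t} x)"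
    using st by (auto simp: indicator_def fun_eq_iff)
  finally show "L2_inner ?\<mu> f (indicator {s<..t})
      = stieltjes_primitive a b \<rho> f t - stieltjes_primitive a b \<rho> f s"
    by (simp add: L2_inner_def)
qed

lemma stieltjes_primitive_left:
  assumes cont: "continuous_on {a..b} \<rho>" and mono: "mono_on {a..b} \<rho>" and "a \<le> b"
  shows "stieltjes_primitive a b \<rho> f a = 0"
proof -
  have "{a..a} \<in> null_sets (stieltjes_measure a b \<rho>)"
    using emeasure_stieltjes_interval[OF cont mono, of a a] \<open>a \<le> b\<close> by (auto simp: null_sets_def)
  then have "AE x in stieltjes_measure a b \<rho>. x \<notin> {a..a}"
    by (rule AE_not_in)
  then show ?thesis
    unfolding stieltjes_primitive_def set_lebesgue_integral_def
    by (intro integral_eq_zero_AE) (auto elim!: eventually_mono)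
qed

section \<open>Independence from characteristic functions\<close>

text \<open>
  If \<open>V\<close> is uncorrelated with all exponentials of \<open>Y\<close>, then it is uncorrelated with all indicators
  of \<open>Y\<close>. Reweighting the probability by \<open>V + 2\<close>, normalized, leaves the characteristic function
  of \<open>Y\<close> unchanged, hence leaves the law of \<open>Y\<close> unchanged by Levy's uniqueness theorem.
\<close>

lemma (in prob_space) indicator_factor_real:
  fixes V Y :: "'a \<Rightarrow> real"
  assumes V[measurable]: "random_variable borel V" and bd: "\<And>\<omega>. \<bar>V \<omega>\<bar> \<le> 1"
    and Y[measurable]: "random_variable borel Y"
    and factor: "\<And>u. (CLINT \<omega>|M. V \<omega> * iexp (u * Y \<omega>)) = expectation V * char (distr M borel Y) u"
    and B[measurable]: "B \<in> sets borel"
  shows "expectation (\<lambda>\<omega>. V \<omega> * indicator B (Y \<omega>)) = expectation V * prob (Y -` B \<inter> space M)"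
proof -
  have iV: "integrable M V"
    using bd by (intro integrable_const_bound[of _ 1]) auto
  have iVB: "integrable M (\<lambda>\<omega>. V \<omega> * indicator B (Y \<omega>))"
    using bd by (intro integrable_const_bound[of _ 1]) (auto simp: indicator_def)
  have iB: "integrable M (\<lambda>\<omega>. indicator B (Y \<omega>) :: real)"
    by (intro integrable_const_bound[of _ 1]) (auto simp: indicator_def)
  have ie: "integrable M (\<lambda>\<omega>. iexp (u * Y \<omega>))" for u
    by (intro integrable_const_bound[of _ 1]) auto
  have iVe: "integrable M (\<lambda>\<omega>. V \<omega> * iexp (u * Y \<omega>))" for u
    using bd by (intro integrable_const_bound[of _ 1]) (auto simp: norm_mult)
  \<comment> \<open>Adding 2 rather than 1 keeps the total mass at least 1, so that normalizing is always possible.\<close>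
  define c where "c = expectation V + 2"
  have "- 1 \<le> V \<omega>" for \<omega>
    using bd[of \<omega>] by (simp add: abs_le_iff)
  then have "expectation (\<lambda>_. - 1) \<le> expectation V"
    using iV by (intro integral_mono) auto
  then have c: "c \<ge> 1" by (simp add: c_def prob_space)
  define w where "w = (\<lambda>\<omega>. (V \<omega> + 2) / c)"
  have w[measurable]: "w \<in> borel_measurable M" unfolding w_def by simp
  have w0: "w \<omega> \<ge> 0" for \<omega>
    using bd[of \<omega>] c by (auto simp: w_def abs_le_iff)
  have iw: "integrable M w" unfolding w_def using iV by simp
  have ew: "expectation w = 1"
    unfolding w_def using iV c by (simp add: c_def prob_space)
  define D where "D = density M w"
  have D_borel: "Y \<in> borel_measurable D" unfolding D_def by simp
  have "emeasure D (space D) = 1"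
    using ew iw w0 by (simp add: D_def emeasure_density nn_integral_eq_integral cong: nn_integral_cong)
  then interpret D: prob_space D by (rule prob_spaceI)
  have char_eq: "char (distr D borel Y) = char (distr M borel Y)"
  proof
    fix u
    have "char (distr D borel Y) u = (CLINT \<omega>|D. iexp (u * Y \<omega>))"
      unfolding char_def using D_borel by (subst integral_distr) auto
    also have "\<dots> = (CLINT \<omega>|M. w \<omega> *\<^sub>R iexp (u * Y \<omega>))"
      unfolding D_def using w0 by (subst integral_density) auto
    also have "\<dots> = (CLINT \<omega>|M. (V \<omega> * iexp (u * Y \<omega>) + 2 * iexp (u * Y \<omega>)) / c)"
      by (intro Bochner_Integration.integral_cong refl)
        (simp add: w_def scaleR_conv_of_real add_divide_distrib distrib_right)
    also have "\<dots> = ((CLINT \<omega>|M. V \<omega> * iexp (u * Y \<omega>)) + 2 * (CLINT \<omega>|M. iexp (u * Y \<omega>))) / c"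
      using iVe[of u] ie[of u] by simp
    also have "(CLINT \<omega>|M. iexp (u * Y \<omega>)) = char (distr M borel Y) u"
      unfolding char_def by (subst integral_distr) auto
    also have "((CLINT \<omega>|M. V \<omega> * iexp (u * Y \<omega>)) + 2 * char (distr M borel Y) u) / c
        = (expectation V + 2) / c * char (distr M borel Y) u"
      unfolding factor by (simp add: field_simps)
    also have "\<dots> = char (distr M borel Y) u"
    proof -
      have c': "expectation V + 2 = c"
        by (simp add: c_def)
      show ?thesis
        unfolding c' using c by simp
    qed
    finally show "char (distr D borel Y) u = char (distr M borel Y) u" .
  qed
  have "distr D borel Y = distr M borel Y"
    by (rule Levy_uniqueness[OF D.real_distribution_distr[OF D_borel] real_distribution_distr[OF Y] char_eq])
  then have "measure (distr D borel Y) B = prob (Y -` B \<inter> space M)"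
    by (simp add: measure_distr)
  moreover have "measure (distr D borel Y) B = (LINT \<omega>|D. indicator B (Y \<omega>))"
  proof -
    have "measure (distr D borel Y) B = (LINT x|distr D borel Y. indicator B x)"
      by simp
    also have "\<dots> = (LINT \<omega>|D. indicator B (Y \<omega>))"
      using D_borel by (subst integral_distr) auto
    finally show ?thesis .
  qed
  moreover have "(LINT \<omega>|D. indicator B (Y \<omega>)) = expectation (\<lambda>\<omega>. w \<omega> * indicator B (Y \<omega>))"
    unfolding D_def using w0 by (subst integral_density) auto
  moreover have "(\<lambda>\<omega>. w \<omega> * indicator B (Y \<omega>)) = (\<lambda>\<omega>. (V \<omega> * indicator B (Y \<omega>) + 2 * indicator B (Y \<omega>)) / c)"
    by (simp add: w_def add_divide_distrib distrib_right)
  moreover have "expectation (\<lambda>\<omega>. (V \<omega> * indicator B (Y \<omega>) + 2 * indicator B (Y \<omega>)) / c)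
      = (expectation (\<lambda>\<omega>. V \<omega> * indicator B (Y \<omega>)) + 2 * expectation (\<lambda>\<omega>. indicator B (Y \<omega>))) / c"
    using iVB iB by simp
  moreover have "expectation (\<lambda>\<omega>. indicator B (Y \<omega>) :: real) = prob (Y -` B \<inter> space M)"
  proof -
    have "expectation (\<lambda>\<omega>. indicator B (Y \<omega>) :: real) = expectation (indicator (Y -` B \<inter> space M))"
      by (intro Bochner_Integration.integral_cong refl) (auto simp: indicator_def)
    then show ?thesis by simp
  qed
  ultimately have "prob (Y -` B \<inter> space M) =
      (expectation (\<lambda>\<omega>. V \<omega> * indicator B (Y \<omega>)) + 2 * prob (Y -` B \<inter> space M)) / c"
    by simp
  then show ?thesis
    using c by (simp add: field_simps c_def)
qed

text \<open>
  The real and imaginary parts of \<open>W\<close> are linear combinations of \<open>W\<close> and its conjugate; hence the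
  two factorization hypotheses.
\<close>

lemma (in prob_space) indicator_factor:
  fixes W :: "'a \<Rightarrow> complex" and Y :: "'a \<Rightarrow> real"
  assumes W[measurable]: "random_variable borel W" and bd: "\<And>\<omega>. norm (W \<omega>) \<le> 1"
    and Y[measurable]: "random_variable borel Y"
    and factor: "\<And>u. (CLINT \<omega>|M. W \<omega> * iexp (u * Y \<omega>)) = (CLINT \<omega>|M. W \<omega>) * char (distr M borel Y) u"
    and factor': "\<And>u. (CLINT \<omega>|M. cnj (W \<omega>) * iexp (u * Y \<omega>)) = (CLINT \<omega>|M. cnj (W \<omega>)) * char (distr M borel Y) u"
    and B[measurable]: "B \<in> sets borel"
  shows "(CLINT \<omega>|M. W \<omega> * of_real (indicator B (Y \<omega>))) = (CLINT \<omega>|M. W \<omega>) * prob (Y -` B \<inter> space M)"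
proof -
  have Wc[measurable]: "(\<lambda>\<omega>. cnj (W \<omega>)) \<in> borel_measurable M"
    by (intro borel_measurable_continuous_on[OF _ W] continuous_intros)
  have bdc: "norm (cnj (W \<omega>)) \<le> 1" for \<omega> using bd[of \<omega>] by simp
  have i: "integrable M W" "integrable M (\<lambda>\<omega>. cnj (W \<omega>))"
    using bd by (auto intro!: integrable_const_bound[of _ 1])
  have ie: "integrable M (\<lambda>\<omega>. W \<omega> * iexp (u * Y \<omega>))"
      "integrable M (\<lambda>\<omega>. cnj (W \<omega>) * iexp (u * Y \<omega>))" for u
    using bd by (auto intro!: integrable_const_bound[of _ 1] simp: norm_mult)
  have iB: "integrable M (\<lambda>\<omega>. Re (W \<omega>) * indicator B (Y \<omega>))"
     "integrable M (\<lambda>\<omega>. Im (W \<omega>) * indicator B (Y \<omega>))"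
    using order_trans[OF abs_Re_le_cmod bd] order_trans[OF abs_Im_le_cmod bd]
    by (auto intro!: integrable_const_bound[of _ 1] simp: indicator_def)
  have re: "expectation (\<lambda>\<omega>. Re (W \<omega>) * indicator B (Y \<omega>)) = expectation (\<lambda>\<omega>. Re (W \<omega>)) * prob (Y -` B \<inter> space M)"
  proof (rule indicator_factor_real)
    fix u
    have "(CLINT \<omega>|M. of_real (Re (W \<omega>)) * iexp (u * Y \<omega>))
        = (CLINT \<omega>|M. (W \<omega> * iexp (u * Y \<omega>) + cnj (W \<omega>) * iexp (u * Y \<omega>)) / 2)"
      by (intro Bochner_Integration.integral_cong refl)
        (simp add: complex_add_cnj distrib_right[symmetric])
    also have "\<dots> = (CLINT \<omega>|M. (W \<omega> + cnj (W \<omega>)) / 2) * char (distr M borel Y) u"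
      using i ie[of u] by (simp add: factor factor' distrib_right add_divide_distrib del: of_real_mult)
    also have "(CLINT \<omega>|M. (W \<omega> + cnj (W \<omega>)) / 2) = (CLINT \<omega>|M. of_real (Re (W \<omega>)))"
      by (simp add: complex_add_cnj)
    finally show "(CLINT \<omega>|M. of_real (Re (W \<omega>)) * iexp (u * Y \<omega>))
        = of_real (expectation (\<lambda>\<omega>. Re (W \<omega>))) * char (distr M borel Y) u"
      by simp
  qed (auto intro: order_trans[OF abs_Re_le_cmod bd])
  have im: "expectation (\<lambda>\<omega>. Im (W \<omega>) * indicator B (Y \<omega>)) = expectation (\<lambda>\<omega>. Im (W \<omega>)) * prob (Y -` B \<inter> space M)"
  proof (rule indicator_factor_real)
    fix u
    have "(CLINT \<omega>|M. of_real (Im (W \<omega>)) * iexp (u * Y \<omega>))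
        = (CLINT \<omega>|M. (W \<omega> * iexp (u * Y \<omega>) - cnj (W \<omega>) * iexp (u * Y \<omega>)) / (2 * \<i>))"
    proof -
      have "complex_of_real (Im z) = (z - cnj z) / (2 * \<i>)" for z
        by (simp add: complex_eq_iff)
      then show ?thesis
        by (simp only: left_diff_distrib times_divide_eq_left)
    qed
    also have "\<dots> = (CLINT \<omega>|M. (W \<omega> - cnj (W \<omega>)) / (2 * \<i>)) * char (distr M borel Y) u"
      using i ie[of u] by (simp add: factor factor' left_diff_distrib diff_divide_distrib del: of_real_mult)
    also have "(CLINT \<omega>|M. (W \<omega> - cnj (W \<omega>)) / (2 * \<i>)) = (CLINT \<omega>|M. of_real (Im (W \<omega>)))"
      by (intro Bochner_Integration.integral_cong refl) (simp add: complex_eq_iff)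
    finally show "(CLINT \<omega>|M. of_real (Im (W \<omega>)) * iexp (u * Y \<omega>))
        = of_real (expectation (\<lambda>\<omega>. Im (W \<omega>))) * char (distr M borel Y) u"
      by simp
  qed (auto intro: order_trans[OF abs_Im_le_cmod bd])
  have iWB: "integrable M (\<lambda>\<omega>. W \<omega> * of_real (indicator B (Y \<omega>)))"
    using bd by (auto intro!: integrable_const_bound[of _ 1] simp: norm_mult indicator_def)
  show ?thesis
    using re im by (intro complex_eqI) (simp_all add: integral_Re[OF iWB, symmetric] integral_Im[OF iWB, symmetric]
        integral_Re[OF i(1), symmetric] integral_Im[OF i(1), symmetric])
qed

text \<open>
  Kac's theorem. The exponentials are replaced by indicators one index at a time; after all
  indices have been treated the product formula is the definition of independence.
\<close>

lemma (in prob_space) indep_vars_char: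
  fixes Y :: "'i \<Rightarrow> 'a \<Rightarrow> real"
  assumes I: "finite I" and Y: "\<And>i. i \<in> I \<Longrightarrow> random_variable borel (Y i)"
    and factor: "\<And>u. (CLINT \<omega>|M. iexp (\<Sum>i\<in>I. u i * Y i \<omega>)) = (\<Prod>i\<in>I. char (distr M borel (Y i)) (u i))"
  shows "indep_vars (\<lambda>_. borel) Y I"
proof -
  \<comment> \<open>\<open>F\<close> is the set of indices whose exponential has already been replaced by an indicator.\<close>
  define G where "G F B u i \<omega> = (if i \<in> F then of_real (indicator (B i) (Y i \<omega>)) else iexp (u i * Y i \<omega>))"
    for F B u i \<omega>
  define g where "g F B u i = (if i \<in> F then of_real (prob (Y i -` B i \<inter> space M)) else char (distr M borel (Y i)) (u i))"
    for F B u i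
  have main: "(CLINT \<omega>|M. \<Prod>i\<in>I. G F B u i \<omega>) = (\<Prod>i\<in>I. g F B u i)"
    if "finite F" "F \<subseteq> I" and B: "\<And>i. B i \<in> sets borel" for F B u
    using that(1,2)
  proof (induction F arbitrary: u)
    case empty
    show ?case
    proof -
      have "iexp (\<Sum>i\<in>I. u i * Y i \<omega>) = (\<Prod>i\<in>I. G {} B u i \<omega>)" for \<omega>
        using I by (simp add: G_def exp_sum sum_distrib_left)
      then show ?thesis
        using factor[of u] by (simp add: g_def)
    qed
  next
    case (insert k F)
    let ?I = "I - {k}"
    define W where "W u \<omega> = (\<Prod>i\<in>?I. G F B u i \<omega>)" for u \<omega>
    define w where "w u = (\<Prod>i\<in>?I. g F B u i)" for u
    have k: "k \<in> I" "k \<notin> F" using insert by auto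
    have [measurable]: "random_variable borel (Y k)" using Y k by simp
    have Gm: "i \<in> I \<Longrightarrow> G F B u i \<in> borel_measurable M" for u i
    proof -
      assume i: "i \<in> I"
      have [measurable]: "Y i \<in> borel_measurable M" "B i \<in> sets borel" using Y[OF i] B by auto
      show "G F B u i \<in> borel_measurable M"
        unfolding G_def by (cases "i \<in> F") auto
    qed
    have Wm: "W u \<in> borel_measurable M" for u
      unfolding W_def using Gm by (intro borel_measurable_prod) auto
    have bd: "norm (W u \<omega>) \<le> 1" for u \<omega>
      unfolding W_def prod_norm[symmetric] by (intro prod_le_1) (auto simp: G_def indicator_def)
    have step: "(CLINT \<omega>|M. W u \<omega> * iexp (v * Y k \<omega>)) = w u * char (distr M borel (Y k)) v" for u v
    proof -
      have W': "W (u(k := v)) = W u" and w': "w (u(k := v)) = w u"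
        unfolding W_def w_def G_def g_def by (intro ext prod.cong; simp)+
      have "(CLINT \<omega>|M. \<Prod>i\<in>I. G F B (u(k := v)) i \<omega>) = (\<Prod>i\<in>I. g F B (u(k := v)) i)"
        using insert by auto
      also have "(\<lambda>\<omega>. \<Prod>i\<in>I. G F B (u(k := v)) i \<omega>) = (\<lambda>\<omega>. iexp (v * Y k \<omega>) * W (u(k := v)) \<omega>)"
        using I k by (simp add: prod.remove[of I k] W_def G_def)
      also have "(\<Prod>i\<in>I. g F B (u(k := v)) i) = char (distr M borel (Y k)) v * w (u(k := v))"
        using I k by (simp add: prod.remove[of I k] w_def g_def)
      finally show ?thesis by (simp add: W' w' mult.commute)
    qed
    have char0: "char (distr M borel (Y k)) 0 = 1"
      by (intro real_distribution.char_zero real_distribution_distr) simp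
    have exp_W: "(CLINT \<omega>|M. W u \<omega>) = w u" for u
      using step[of u 0] by (simp add: char0)
    \<comment> \<open>Conjugation only changes the signs of the frequencies, so the induction hypothesis, being
      general in \<open>u\<close>, covers the conjugate as well.\<close>
    have cnj_W: "cnj (W u \<omega>) = W (\<lambda>i. - u i) \<omega>" for u \<omega>
      unfolding W_def cnj_prod by (intro prod.cong refl) (auto simp: G_def exp_cnj)
    have "(CLINT \<omega>|M. W u \<omega> * of_real (indicator (B k) (Y k \<omega>))) = w u * prob (Y k -` B k \<inter> space M)"
      using indicator_factor[OF Wm bd _ _ _ B, of "Y k" u k] by (simp add: step exp_W cnj_W del: of_real_mult)
    moreover have "(\<Prod>i\<in>I. G (insert k F) B u i \<omega>) = W u \<omega> * of_real (indicator (B k) (Y k \<omega>))" for \<omega>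
    proof -
      have "(\<Prod>i\<in>?I. G (insert k F) B u i \<omega>) = W u \<omega>"
        unfolding W_def by (intro prod.cong) (auto simp: G_def)
      then show ?thesis
        using I k by (simp add: prod.remove[of I k]) (simp add: G_def)
    qed
    moreover have "(\<Prod>i\<in>I. g (insert k F) B u i) = w u * prob (Y k -` B k \<inter> space M)"
    proof -
      have "(\<Prod>i\<in>?I. g (insert k F) B u i) = w u"
        unfolding w_def by (intro prod.cong) (auto simp: g_def)
      then show ?thesis
        using I k by (simp add: prod.remove[of I k]) (simp add: g_def)
    qed
    ultimately show ?case by simp
  qed
  show ?thesis
    unfolding indep_vars_def2
  proof (intro conjI ballI indep_setsI)
    fix A J assume J: "J \<noteq> {}" "J \<subseteq> I" "finite J" and "\<forall>j\<in>J. A j \<in> {Y j -` A \<inter> space M |A. A \<in> sets borel}"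
    then have "\<forall>j\<in>J. \<exists>B. B \<in> sets borel \<and> A j = Y j -` B \<inter> space M" by auto
    then obtain B0 where B0: "\<And>j. j \<in> J \<Longrightarrow> B0 j \<in> sets borel \<and> A j = Y j -` B0 j \<inter> space M"
      by metis
    define B where "B j = (if j \<in> J then B0 j else UNIV)" for j
    have B: "B j \<in> sets borel" for j using B0 by (auto simp: B_def)
    have A: "A j = Y j -` B j \<inter> space M" if "j \<in> J" for j using B0 that by (auto simp: B_def)
    have eq: "(CLINT \<omega>|M. \<Prod>i\<in>I. G I B (\<lambda>_. 0) i \<omega>) = (\<Prod>i\<in>I. g I B (\<lambda>_. 0) i)"
      using I B by (intro main) auto
    have "(\<Prod>i\<in>I. g I B (\<lambda>_. 0) i) = of_real (\<Prod>i\<in>I. prob (Y i -` B i \<inter> space M))"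
      by (simp add: g_def)
    also have "(\<Prod>i\<in>I. prob (Y i -` B i \<inter> space M)) = (\<Prod>i\<in>J. prob (A i))"
      using J I A by (intro prod.mono_neutral_cong_right) (auto simp: B_def prob_space)
    finally have 1: "(\<Prod>i\<in>I. g I B (\<lambda>_. 0) i) = of_real (\<Prod>i\<in>J. prob (A i))" .
    have ev: "(\<Inter>j\<in>J. A j) \<in> events"
      using J measurable_sets[OF Y B] by (intro sets.finite_INT) (auto simp: A)
    have "(\<Prod>i\<in>I. G I B (\<lambda>_. 0) i \<omega>) = of_real (indicator (\<Inter>j\<in>J. A j) \<omega>)" if "\<omega> \<in> space M" for \<omega>
    proof -
      have "(\<Prod>i\<in>I. G I B (\<lambda>_. 0) i \<omega>) = of_real (\<Prod>i\<in>I. indicator (B i) (Y i \<omega>))"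
        by (simp add: G_def)
      also have "(\<Prod>i\<in>I. indicator (B i) (Y i \<omega>)) = (\<Prod>i\<in>J. indicator (A i) \<omega> :: real)"
        using J I A that by (intro prod.mono_neutral_cong_right) (auto simp: B_def indicator_def)
      also have "\<dots> = indicator (\<Inter>j\<in>J. A j) \<omega>"
        using J by (auto simp: indicator_def)
      finally show ?thesis .
    qed
    then have "(CLINT \<omega>|M. \<Prod>i\<in>I. G I B (\<lambda>_. 0) i \<omega>) = (CLINT \<omega>|M. of_real (indicator (\<Inter>j\<in>J. A j) \<omega>))"
      by (intro Bochner_Integration.integral_cong refl)
    also have "\<dots> = of_real (expectation (indicator (\<Inter>j\<in>J. A j)))"
      by (rule integral_complex_of_real)
    also have "\<dots> = of_real (prob (\<Inter>j\<in>J. A j))"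
      using ev by simp
    finally have "complex_of_real (prob (\<Inter>j\<in>J. A j)) = of_real (\<Prod>i\<in>J. prob (A i))"
      using eq 1 by simp
    then show "prob (\<Inter>j\<in>J. A j) = (\<Prod>j\<in>J. prob (A j))"
      by (simp only: of_real_eq_iff)
  qed (use Y in \<open>auto intro: measurable_sets\<close>)
qed

section \<open>Normal laws\<close>

lemma normal_law_eq_distr:
  assumes "0 \<le> v"
  shows "normal_law m v = distr std_normal_distribution borel (\<lambda>x. m + sqrt v * x)"
proof -
  interpret N: real_distribution std_normal_distribution
    by (rule real_dist_normal_dist)
  show ?thesis
  proof (cases "v = 0")
    case True
    then show ?thesis
      by (simp add: normal_law_def N.distr_const)
  next
    case False
    then have v: "v > 0" using assms by simp
    have "distributed std_normal_distribution lborel (\<lambda>x. x) std_normal_density"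
      by (simp add: distributed_def distr_id2)
    then have "distributed std_normal_distribution lborel (\<lambda>x. m + sqrt v * x)
        (normal_density (m + sqrt v * 0) (\<bar>sqrt v\<bar> * 1))"
      using v by (intro N.normal_density_affine) auto
    then have "distr std_normal_distribution lborel (\<lambda>x. m + sqrt v * x)
        = density lborel (normal_density m (sqrt v))"
      using v by (simp add: distributed_def)
    also have "distr std_normal_distribution lborel (\<lambda>x. m + sqrt v * x)
        = distr std_normal_distribution borel (\<lambda>x. m + sqrt v * x)"
      by (rule distr_cong) auto
    finally show ?thesis
      using v by (simp add: normal_law_def)
  qed
qed

lemma real_distribution_normal_law: "0 \<le> v \<Longrightarrow> real_distribution (normal_law m v)"
  unfolding normal_law_eq_distr
  using real_dist_normal_dist
  by (intro prob_space.real_distribution_distr) (auto simp: real_distribution_def)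

lemma char_normal_law:
  assumes "0 \<le> v"
  shows "char (normal_law m v) t = iexp (t * m) * exp (- v * t\<^sup>2 / 2)"
proof -
  have "char (normal_law m v) t = (CLINT x|std_normal_distribution. iexp (t * (m + sqrt v * x)))"
    unfolding normal_law_eq_distr[OF assms] char_def by (subst integral_distr) auto
  also have "\<dots> = (CLINT x|std_normal_distribution. iexp (t * m) * iexp ((t * sqrt v) * x))"
    by (intro Bochner_Integration.integral_cong refl) (simp add: algebra_simps flip: exp_add)
  also have "\<dots> = iexp (t * m) * char std_normal_distribution (t * sqrt v)"
    by (simp add: char_def)
  also have "\<dots> = iexp (t * m) * exp (- v * t\<^sup>2 / 2)"
    using assms by (simp add: char_std_normal_distribution power_mult_distrib mult.commute)
  finally show ?thesis .
qed

lemma second_moment_normal_law: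
  assumes "0 \<le> v"
  shows "integrable (normal_law 0 v) (\<lambda>x. x\<^sup>2)" "(LINT x|normal_law 0 v. x\<^sup>2) = v"
proof -
  have i: "integrable std_normal_distribution (\<lambda>x. x\<^sup>2)"
    by (rule integrable_std_normal_distribution_moment)
  show "integrable (normal_law 0 v) (\<lambda>x. x\<^sup>2)"
    unfolding normal_law_eq_distr[OF assms] using i
    by (subst integrable_distr_eq) (auto simp: power_mult_distrib)
  have "(LINT x|normal_law 0 v. x\<^sup>2) = (LINT x|std_normal_distribution. v * x\<^sup>2)"
    unfolding normal_law_eq_distr[OF assms] using assms
    by (subst integral_distr) (auto simp: power_mult_distrib)
  also have "\<dots> = v"
    using std_normal_distribution_even_moments(1)[of 1] by simp
  finally show "(LINT x|normal_law 0 v. x\<^sup>2) = v" .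
qed

section \<open>Series of independent standard Gaussian variables\<close>

locale gaussian_sequence = prob_space M for M :: "'w measure" +
  fixes \<xi> :: "nat \<Rightarrow> 'w \<Rightarrow> real"
  assumes indep: "indep_vars (\<lambda>_. borel) \<xi> UNIV"
    and gauss: "\<And>n. distributed M lborel (\<xi> n) std_normal_density"
begin

abbreviation partial :: "(nat \<Rightarrow> real) \<Rightarrow> nat \<Rightarrow> 'w \<Rightarrow> real" where
  "partial c n \<omega> \<equiv> \<Sum>i<n. c i * \<xi> i \<omega>"

lemma xi_measurable[measurable]: "\<xi> n \<in> borel_measurable M"
  using gauss[of n] by (simp add: distributed_def)

lemma distr_xi: "distr M borel (\<xi> n) = std_normal_distribution"
proof -
  have "distr M borel (\<xi> n) = distr M lborel (\<xi> n)"
    by (rule distr_cong) auto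
  then show ?thesis using gauss[of n] by (simp add: distributed_def)
qed

lemma xi_moments:
  "integrable M (\<lambda>\<omega>. \<xi> n \<omega> ^ k)"
  "expectation (\<lambda>\<omega>. \<xi> n \<omega>) = 0"
  "expectation (\<lambda>\<omega>. \<xi> n \<omega> ^ 2) = 1"
  "expectation (\<lambda>\<omega>. \<xi> n \<omega> ^ 3) = 0"
  "expectation (\<lambda>\<omega>. \<xi> n \<omega> ^ 4) = 3"
proof -
  have "integrable (distr M borel (\<xi> n)) (\<lambda>x. x ^ k)"
    unfolding distr_xi by (rule integrable_std_normal_distribution_moment)
  then show "integrable M (\<lambda>\<omega>. \<xi> n \<omega> ^ k)"
    by (subst (asm) integrable_distr_eq) auto
  have E: "expectation (\<lambda>\<omega>. \<xi> n \<omega> ^ k) = (LINT x|std_normal_distribution. x ^ k)" for k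
    unfolding distr_xi[of n, symmetric] by (subst integral_distr) auto
  show "expectation (\<lambda>\<omega>. \<xi> n \<omega>) = 0" "expectation (\<lambda>\<omega>. \<xi> n \<omega> ^ 3) = 0"
    using E[of 1] E[of 3] integral_std_normal_distribution_moment_odd[of 1]
      integral_std_normal_distribution_moment_odd[of 3] by auto
  show "expectation (\<lambda>\<omega>. \<xi> n \<omega> ^ 2) = 1" "expectation (\<lambda>\<omega>. \<xi> n \<omega> ^ 4) = 3"
    using E[of 2] E[of 4] std_normal_distribution_even_moments(1)[of 1]
      std_normal_distribution_even_moments(1)[of 2] by (auto simp: fact_numeral)
qed

text \<open>
  The sequence is handled as a martingale through this lemma: \<open>\<xi> n\<close> is independent of every
  function of the preceding variables.
\<close>

lemma past_times_next:
  fixes g :: "(nat \<Rightarrow> real) \<Rightarrow> real"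
  assumes g[measurable]: "g \<in> borel_measurable (PiM {..<n} (\<lambda>_. borel))"
    and int: "integrable M (\<lambda>\<omega>. g (restrict (\<lambda>i. \<xi> i \<omega>) {..<n}))"
  shows "integrable M (\<lambda>\<omega>. g (restrict (\<lambda>i. \<xi> i \<omega>) {..<n}) * \<xi> n \<omega> ^ k)"
    and "expectation (\<lambda>\<omega>. g (restrict (\<lambda>i. \<xi> i \<omega>) {..<n}) * \<xi> n \<omega> ^ k)
      = expectation (\<lambda>\<omega>. g (restrict (\<lambda>i. \<xi> i \<omega>) {..<n})) * expectation (\<lambda>\<omega>. \<xi> n \<omega> ^ k)"
proof -
  have "indep_var (PiM {..<n} (\<lambda>_. borel)) (\<lambda>\<omega>. restrict (\<lambda>i. \<xi> i \<omega>) {..<n})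
      (PiM {n} (\<lambda>_. borel)) (\<lambda>\<omega>. restrict (\<lambda>i. \<xi> i \<omega>) {n})"
    by (rule indep_var_restrict[OF indep]) auto
  then have "indep_var borel (g \<circ> (\<lambda>\<omega>. restrict (\<lambda>i. \<xi> i \<omega>) {..<n}))
      borel ((\<lambda>p. p n ^ k) \<circ> (\<lambda>\<omega>. restrict (\<lambda>i. \<xi> i \<omega>) {n}))"
    by (rule indep_var_compose) (auto intro!: borel_measurable_power measurable_component_singleton)
  then have *: "indep_var borel (\<lambda>\<omega>. g (restrict (\<lambda>i. \<xi> i \<omega>) {..<n})) borel (\<lambda>\<omega>. \<xi> n \<omega> ^ k)"
    by (simp add: comp_def)
  show "integrable M (\<lambda>\<omega>. g (restrict (\<lambda>i. \<xi> i \<omega>) {..<n}) * \<xi> n \<omega> ^ k)"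
    by (rule indep_var_integrable[OF * int xi_moments(1)])
  show "expectation (\<lambda>\<omega>. g (restrict (\<lambda>i. \<xi> i \<omega>) {..<n}) * \<xi> n \<omega> ^ k)
      = expectation (\<lambda>\<omega>. g (restrict (\<lambda>i. \<xi> i \<omega>) {..<n})) * expectation (\<lambda>\<omega>. \<xi> n \<omega> ^ k)"
    by (rule indep_var_lebesgue_integral[OF * int xi_moments(1)])
qed

definition hit :: "(nat \<Rightarrow> real) \<Rightarrow> real \<Rightarrow> nat \<Rightarrow> 'w set" where
  "hit c x n = {\<omega> \<in> space M. \<exists>k\<le>n. x \<le> \<bar>partial c k \<omega>\<bar>}"

lemma hit_sets[measurable]: "hit c x n \<in> sets M"
  unfolding hit_def by measurable

lemma past_measurable:
  fixes k n :: nat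
  assumes "k \<le> n"
  shows "(\<lambda>p. \<Sum>i<k. c i * p i) \<in> borel_measurable (PiM {..<n} (\<lambda>_. borel :: real measure))"
  using assms by (intro borel_measurable_sum borel_measurable_times measurable_component_singleton) auto

lemma partial_power_past:
  fixes n :: nat
  shows "(\<lambda>p. (\<Sum>i<n. c i * p i) ^ j) \<in> borel_measurable (PiM {..<n} (\<lambda>_. borel :: real measure))"
  by (intro borel_measurable_power past_measurable) auto

lemma partial_power_integrable: "integrable M (\<lambda>\<omega>. partial c n \<omega> ^ k)"
proof (induction n arbitrary: k)
  case (Suc n)
  have i: "integrable M (\<lambda>\<omega>. partial c n \<omega> ^ j * \<xi> n \<omega> ^ l)" for j l
    using past_times_next(1)[OF partial_power_past[where c=c and n=n and j=j], of l] Suc[of j] by simp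
  have "integrable M (\<lambda>\<omega>. \<Sum>j\<le>k. (of_nat (k choose j) * c n ^ (k - j)) * (partial c n \<omega> ^ j * \<xi> n \<omega> ^ (k - j)))"
    by (intro Bochner_Integration.integrable_sum integrable_mult_right i)
  also have "(\<lambda>\<omega>. \<Sum>j\<le>k. (of_nat (k choose j) * c n ^ (k - j)) * (partial c n \<omega> ^ j * \<xi> n \<omega> ^ (k - j)))
      = (\<lambda>\<omega>. partial c (Suc n) \<omega> ^ k)"
    by (simp add: binomial_ring power_mult_distrib mult_ac)
  finally show ?case .
qed simp

lemma partial_moments:
  "expectation (\<lambda>\<omega>. (partial c n \<omega>)\<^sup>2) = (\<Sum>i<n. (c i)\<^sup>2)"
  "expectation (\<lambda>\<omega>. partial c n \<omega> ^ 4) = 3 * (\<Sum>i<n. (c i)\<^sup>2)\<^sup>2"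
proof (induction n)
  case (Suc n)
  let ?S = "partial c n"
  have i: "integrable M (\<lambda>\<omega>. ?S \<omega> ^ j * \<xi> n \<omega> ^ l)"
    and e: "expectation (\<lambda>\<omega>. ?S \<omega> ^ j * \<xi> n \<omega> ^ l) = expectation (\<lambda>\<omega>. ?S \<omega> ^ j) * expectation (\<lambda>\<omega>. \<xi> n \<omega> ^ l)" for j l
    using past_times_next[OF partial_power_past[where c=c and n=n and j=j], of l] partial_power_integrable[of c n j] by auto
  have "(\<lambda>\<omega>. (partial c (Suc n) \<omega>)\<^sup>2)
      = (\<lambda>\<omega>. ?S \<omega> ^ 2 * \<xi> n \<omega> ^ 0 + (2 * c n) * (?S \<omega> ^ 1 * \<xi> n \<omega> ^ 1) + (c n)\<^sup>2 * (?S \<omega> ^ 0 * \<xi> n \<omega> ^ 2))"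
    by (auto simp: power2_eq_square algebra_simps)
  then have "expectation (\<lambda>\<omega>. (partial c (Suc n) \<omega>)\<^sup>2) = expectation (\<lambda>\<omega>. ?S \<omega> ^ 2 * \<xi> n \<omega> ^ 0)
      + (2 * c n) * expectation (\<lambda>\<omega>. ?S \<omega> ^ 1 * \<xi> n \<omega> ^ 1) + (c n)\<^sup>2 * expectation (\<lambda>\<omega>. ?S \<omega> ^ 0 * \<xi> n \<omega> ^ 2)"
    by (simp only: i Bochner_Integration.integral_add Bochner_Integration.integrable_add
        integrable_mult_right integral_mult_right_zero)
  also have "\<dots> = (\<Sum>i<Suc n. (c i)\<^sup>2)"
    unfolding e using Suc by (simp add: xi_moments prob_space)
  finally show "expectation (\<lambda>\<omega>. (partial c (Suc n) \<omega>)\<^sup>2) = (\<Sum>i<Suc n. (c i)\<^sup>2)" .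
  have "(s + c n * y) ^ 4 = s ^ 4 * y ^ 0 + (4 * c n) * (s ^ 3 * y ^ 1) + (6 * (c n) ^ 2) * (s ^ 2 * y ^ 2)
      + (4 * c n ^ 3) * (s ^ 1 * y ^ 3) + c n ^ 4 * (s ^ 0 * y ^ 4)" for s y :: real
    by (simp add: power2_eq_square power3_eq_cube power4_eq_xxxx algebra_simps)
  then have "(\<lambda>\<omega>. partial c (Suc n) \<omega> ^ 4)
      = (\<lambda>\<omega>. ?S \<omega> ^ 4 * \<xi> n \<omega> ^ 0 + (4 * c n) * (?S \<omega> ^ 3 * \<xi> n \<omega> ^ 1) + (6 * (c n) ^ 2) * (?S \<omega> ^ 2 * \<xi> n \<omega> ^ 2)
      + (4 * c n ^ 3) * (?S \<omega> ^ 1 * \<xi> n \<omega> ^ 3) + c n ^ 4 * (?S \<omega> ^ 0 * \<xi> n \<omega> ^ 4))"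
    by (simp only: sum.lessThan_Suc)
  then have "expectation (\<lambda>\<omega>. partial c (Suc n) \<omega> ^ 4) = expectation (\<lambda>\<omega>. ?S \<omega> ^ 4 * \<xi> n \<omega> ^ 0)
      + (4 * c n) * expectation (\<lambda>\<omega>. ?S \<omega> ^ 3 * \<xi> n \<omega> ^ 1)
      + (6 * (c n) ^ 2) * expectation (\<lambda>\<omega>. ?S \<omega> ^ 2 * \<xi> n \<omega> ^ 2)
      + (4 * c n ^ 3) * expectation (\<lambda>\<omega>. ?S \<omega> ^ 1 * \<xi> n \<omega> ^ 3)
      + c n ^ 4 * expectation (\<lambda>\<omega>. ?S \<omega> ^ 0 * \<xi> n \<omega> ^ 4)"
    by (simp only: i Bochner_Integration.integral_add Bochner_Integration.integrable_add
        integrable_mult_right integral_mult_right_zero)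
  also have "\<dots> = 3 * (\<Sum>i<n. (c i)\<^sup>2)\<^sup>2 + 6 * (c n)\<^sup>2 * (\<Sum>i<n. (c i)\<^sup>2) + 3 * c n ^ 4"
    unfolding e using Suc by (simp add: xi_moments prob_space)
  also have "\<dots> = 3 * (\<Sum>i<Suc n. (c i)\<^sup>2)\<^sup>2"
    by (simp add: power2_eq_square power4_eq_xxxx algebra_simps)
  finally show "expectation (\<lambda>\<omega>. partial c (Suc n) \<omega> ^ 4) = 3 * (\<Sum>i<Suc n. (c i)\<^sup>2)\<^sup>2" .
qed simp_all

text \<open>
  Doob's inequality for the submartingale of fourth powers, by induction instead of stopping times.
  On the event \<open>hit c x n\<close> convexity gives \<open>(s + t)\<^sup>4 \<ge> s\<^sup>4 + 4 t s\<^sup>3\<close>, whose linear term has mean 0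
  because the new summand \<open>t\<close> is centred and independent of \<open>s\<close> and of that event; on the part newly
  added to the event the fourth power is at least \<open>x\<^sup>4\<close>.
\<close>

lemma maximal_inequality_hit:
  assumes x: "x > 0"
  shows "x ^ 4 * prob (hit c x n) \<le> expectation (\<lambda>\<omega>. partial c n \<omega> ^ 4 * indicator (hit c x n) \<omega>)"
proof (induction n)
  case 0
  then show ?case using x by (simp add: hit_def)
next
  case (Suc n)
  let ?S = "partial c n" and ?T = "partial c (Suc n)"
  let ?H = "hit c x n" and ?K = "hit c x (Suc n)"
  have sub: "?H \<subseteq> ?K" by (auto simp: hit_def intro: le_SucI)
  \<comment> \<open>The cube of the partial sum, cut off to the event, as a function of the variables before \<open>n\<close>.\<close>
  define g where "g p = (\<Sum>i<n. c i * p i) ^ 3 * of_bool (\<exists>k\<le>n. x \<le> \<bar>\<Sum>i<k. c i * p i\<bar>)" for p :: "nat \<Rightarrow> real"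
  have [measurable]: "(\<lambda>p. \<Sum>i<k. c i * p i) \<in> borel_measurable (PiM {..<n} (\<lambda>_. borel :: real measure))"
    if "k \<in> {..n}" for k using that by (intro past_measurable) auto
  have "Measurable.pred (PiM {..<n} (\<lambda>_. borel :: real measure)) (\<lambda>p. \<exists>k\<in>{..n}. x \<le> \<bar>\<Sum>i<k. c i * p i\<bar>)"
    by measurable
  then have [measurable]: "Measurable.pred (PiM {..<n} (\<lambda>_. borel :: real measure)) (\<lambda>p. \<exists>k\<le>n. x \<le> \<bar>\<Sum>i<k. c i * p i\<bar>)"
    by (simp add: Bex_def)
  have gm: "g \<in> borel_measurable (PiM {..<n} (\<lambda>_. borel))"
    unfolding g_def using partial_power_past[where c=c and n=n and j=3] by measurable
  have geq: "g (restrict (\<lambda>i. \<xi> i \<omega>) {..<n}) = ?S \<omega> ^ 3 * indicator ?H \<omega>" if "\<omega> \<in> space M" for \<omega>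
  proof -
    have "(\<Sum>i<k. c i * restrict (\<lambda>i. \<xi> i \<omega>) {..<n} i) = partial c k \<omega>" if "k \<le> n" for k
      using that by (intro sum.cong) auto
    then show ?thesis
      using that unfolding g_def by (auto simp: hit_def indicator_def)
  qed
  have iH: "integrable M (\<lambda>\<omega>. partial c m \<omega> ^ k * indicator (hit c x j) \<omega>)" for m k j
    by (intro integrable_real_mult_indicator partial_power_integrable hit_sets)
  have ig: "integrable M (\<lambda>\<omega>. g (restrict (\<lambda>i. \<xi> i \<omega>) {..<n}))"
    using iH[of n 3 n] by (subst Bochner_Integration.integrable_cong[OF refl geq])
  have i3: "integrable M (\<lambda>\<omega>. ?S \<omega> ^ 3 * indicator ?H \<omega> * \<xi> n \<omega>)"
    using past_times_next(1)[OF gm ig, of 1] by (subst (asm) Bochner_Integration.integrable_cong[OF refl, where g="\<lambda>\<omega>. ?S \<omega> ^ 3 * indicator ?H \<omega> * \<xi> n \<omega>"]) (auto simp: geq)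
  have "expectation (\<lambda>\<omega>. ?S \<omega> ^ 3 * indicator ?H \<omega> * \<xi> n \<omega>) = expectation (\<lambda>\<omega>. g (restrict (\<lambda>i. \<xi> i \<omega>) {..<n}) * \<xi> n \<omega> ^ 1)"
    by (intro Bochner_Integration.integral_cong refl) (auto simp: geq)
  also have "\<dots> = 0"
    unfolding past_times_next(2)[OF gm ig, of 1] by (simp add: xi_moments)
  finally have e3: "expectation (\<lambda>\<omega>. ?S \<omega> ^ 3 * indicator ?H \<omega> * \<xi> n \<omega>) = 0" .
  have iI: "integrable M (\<lambda>\<omega>. x ^ 4 * (indicator ?K \<omega> - indicator ?H \<omega>))"
    by (intro integrable_mult_right Bochner_Integration.integrable_diff) (auto simp: emeasure_eq_measure)
  have "x ^ 4 * prob ?K = x ^ 4 * prob ?H + x ^ 4 * (prob ?K - prob ?H)"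
    by (simp add: algebra_simps)
  also have "\<dots> \<le> expectation (\<lambda>\<omega>. ?S \<omega> ^ 4 * indicator ?H \<omega>) + x ^ 4 * (prob ?K - prob ?H)"
    using Suc by simp
  also have "\<dots> = expectation (\<lambda>\<omega>. ?S \<omega> ^ 4 * indicator ?H \<omega> + (4 * c n) * (?S \<omega> ^ 3 * indicator ?H \<omega> * \<xi> n \<omega>)
        + x ^ 4 * (indicator ?K \<omega> - indicator ?H \<omega>))"
  proof -
    have "expectation (\<lambda>\<omega>. x ^ 4 * (indicator ?K \<omega> - indicator ?H \<omega>)) = x ^ 4 * (prob ?K - prob ?H)"
      by (subst integral_mult_right_zero, subst Bochner_Integration.integral_diff) (auto simp: emeasure_eq_measure)
    then show ?thesis
      using iH[of n 4 n] i3 iI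
      by (subst Bochner_Integration.integral_add, simp, simp, subst Bochner_Integration.integral_add)
        (auto simp: e3)
  qed
  also have "\<dots> \<le> expectation (\<lambda>\<omega>. ?T \<omega> ^ 4 * indicator ?K \<omega>)"
  proof (rule integral_mono)
    show "integrable M (\<lambda>\<omega>. ?S \<omega> ^ 4 * indicator ?H \<omega> + (4 * c n) * (?S \<omega> ^ 3 * indicator ?H \<omega> * \<xi> n \<omega>)
        + x ^ 4 * (indicator ?K \<omega> - indicator ?H \<omega>))"
      by (intro Bochner_Integration.integrable_add iH integrable_mult_right[OF i3] iI)
    show "integrable M (\<lambda>\<omega>. ?T \<omega> ^ 4 * indicator ?K \<omega>)" by (rule iH)
    fix \<omega> assume \<omega>: "\<omega> \<in> space M"
    have convex: "s ^ 4 + 4 * t * s ^ 3 \<le> (s + t) ^ 4" for s t :: real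
    proof -
      have "(s + t) ^ 4 - (s ^ 4 + 4 * t * s ^ 3) = t\<^sup>2 * ((2 * s + t)\<^sup>2 + 2 * s\<^sup>2)"
        by (simp add: power2_eq_square power3_eq_cube power4_eq_xxxx algebra_simps)
      moreover have "0 \<le> t\<^sup>2 * ((2 * s + t)\<^sup>2 + 2 * s\<^sup>2)" by simp
      ultimately show ?thesis by linarith
    qed
    have "x ^ 4 \<le> ?T \<omega> ^ 4" if "\<omega> \<in> ?K" "\<omega> \<notin> ?H"
    proof -
      have "x \<le> \<bar>?T \<omega>\<bar>"
        using that by (auto simp: hit_def le_Suc_eq)
      then have "x ^ 4 \<le> \<bar>?T \<omega>\<bar> ^ 4"
        using x by (intro power_mono) auto
      then show ?thesis by (simp add: power_even_abs)
    qed
    then show "?S \<omega> ^ 4 * indicator ?H \<omega> + (4 * c n) * (?S \<omega> ^ 3 * indicator ?H \<omega> * \<xi> n \<omega>)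
        + x ^ 4 * (indicator ?K \<omega> - indicator ?H \<omega>) \<le> ?T \<omega> ^ 4 * indicator ?K \<omega>"
      using sub convex[of "?S \<omega>" "c n * \<xi> n \<omega>"]
      by (cases "\<omega> \<in> ?H"; cases "\<omega> \<in> ?K") (auto simp: algebra_simps)
  qed
  finally show ?case .
qed

lemma maximal_inequality:
  assumes x: "x > 0" and c: "summable (\<lambda>i. (c i)\<^sup>2)"
  shows "prob {\<omega> \<in> space M. \<exists>n. x \<le> \<bar>partial c n \<omega>\<bar>} \<le> 3 * (\<Sum>i. (c i)\<^sup>2)\<^sup>2 / x ^ 4"
proof -
  have eq: "{\<omega> \<in> space M. \<exists>n. x \<le> \<bar>partial c n \<omega>\<bar>} = (\<Union>n. hit c x n)"
    by (auto simp: hit_def)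
  have "(\<lambda>n. prob (hit c x n)) \<longlonglongrightarrow> prob (\<Union>n. hit c x n)"
    by (intro finite_Lim_measure_incseq) (auto simp: incseq_def hit_def intro: order_trans)
  moreover have "prob (hit c x n) \<le> 3 * (\<Sum>i. (c i)\<^sup>2)\<^sup>2 / x ^ 4" for n
  proof -
    have "x ^ 4 * prob (hit c x n) \<le> expectation (\<lambda>\<omega>. partial c n \<omega> ^ 4 * indicator (hit c x n) \<omega>)"
      by (rule maximal_inequality_hit[OF x])
    also have "\<dots> \<le> expectation (\<lambda>\<omega>. partial c n \<omega> ^ 4)"
      by (intro integral_mono integrable_real_mult_indicator partial_power_integrable hit_sets)
        (auto simp: indicator_def)
    also have "\<dots> = 3 * (\<Sum>i<n. (c i)\<^sup>2)\<^sup>2" by (rule partial_moments)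
    also have "\<dots> \<le> 3 * (\<Sum>i. (c i)\<^sup>2)\<^sup>2"
      by (intro mult_left_mono power_mono sum_le_suminf c sum_nonneg) auto
    finally show ?thesis using x by (simp add: field_simps)
  qed
  ultimately show "prob {\<omega> \<in> space M. \<exists>n. x \<le> \<bar>partial c n \<omega>\<bar>} \<le> 3 * (\<Sum>i. (c i)\<^sup>2)\<^sup>2 / x ^ 4"
    unfolding eq by (intro LIMSEQ_le_const2) auto
qed

lemma char_partial: "char (distr M borel (partial c n)) t = exp (- (\<Sum>i<n. (c i)\<^sup>2) * t\<^sup>2 / 2)"
proof -
  have "indep_vars (\<lambda>_. borel) (\<lambda>i \<omega>. c i * \<xi> i \<omega>) {..<n}"
    by (rule indep_vars_compose2[where X=\<xi>, OF indep_vars_subset[OF indep]]) auto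
  then have "char (distr M borel (partial c n)) t = (\<Prod>i<n. char (distr M borel (\<lambda>\<omega>. c i * \<xi> i \<omega>)) t)"
    by (rule char_distr_sum)
  also have "\<dots> = (\<Prod>i<n. complex_of_real (exp (- ((c i)\<^sup>2 * t\<^sup>2 / 2))))"
  proof (rule prod.cong[OF refl])
    fix i
    have "char (distr M borel (\<lambda>\<omega>. c i * \<xi> i \<omega>)) t = char (distr M borel (\<xi> i)) (t * c i)"
      unfolding char_def by (subst (1 2) integral_distr) (auto simp: mult_ac)
    then show "char (distr M borel (\<lambda>\<omega>. c i * \<xi> i \<omega>)) t = complex_of_real (exp (- ((c i)\<^sup>2 * t\<^sup>2 / 2)))"
      by (simp add: distr_xi char_std_normal_distribution power_mult_distrib mult.commute)
  qed
  also have "\<dots> = complex_of_real (exp (\<Sum>i<n. - ((c i)\<^sup>2 * t\<^sup>2 / 2)))"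
    by (simp only: exp_sum finite_lessThan of_real_prod)
  also have "(\<Sum>i<n. - ((c i)\<^sup>2 * t\<^sup>2 / 2)) = - (\<Sum>i<n. (c i)\<^sup>2) * t\<^sup>2 / 2"
    by (simp add: sum_negf sum_divide_distrib sum_distrib_right)
  finally show ?thesis by simp
qed

text \<open>
  Along an almost surely convergent sequence of partial sums the characteristic functions converge,
  by dominated convergence, and those of the partial sums are explicit.
\<close>

lemma distr_series:
  assumes c: "(\<lambda>i. (c i)\<^sup>2) sums v" and conv: "AE \<omega> in M. summable (\<lambda>i. c i * \<xi> i \<omega>)"
  shows "distr M borel (\<lambda>\<omega>. \<Sum>i. c i * \<xi> i \<omega>) = normal_law 0 v"
proof (rule Levy_uniqueness)
  have v: "v \<ge> 0"
    using sums_le[OF _ sums_zero c] by simp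
  show "real_distribution (distr M borel (\<lambda>\<omega>. \<Sum>i. c i * \<xi> i \<omega>))" "real_distribution (normal_law 0 v)"
    using v by (auto intro!: real_distribution_distr real_distribution_normal_law)
  show "char (distr M borel (\<lambda>\<omega>. \<Sum>i. c i * \<xi> i \<omega>)) = char (normal_law 0 v)"
  proof
    fix t
    have "(\<lambda>n. char (distr M borel (partial c n)) t) \<longlonglongrightarrow> char (distr M borel (\<lambda>\<omega>. \<Sum>i. c i * \<xi> i \<omega>)) t"
    proof -
      have "(\<lambda>n. CLINT \<omega>|M. iexp (t * partial c n \<omega>)) \<longlonglongrightarrow> (CLINT \<omega>|M. iexp (t * (\<Sum>i. c i * \<xi> i \<omega>)))"
      proof (rule integral_dominated_convergence[where w="\<lambda>_. 1"])
        show "AE \<omega> in M. (\<lambda>n. iexp (t * partial c n \<omega>)) \<longlonglongrightarrow> iexp (t * (\<Sum>i. c i * \<xi> i \<omega>))"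
          using conv by eventually_elim (intro tendsto_intros summable_LIMSEQ)
      qed auto
      then show ?thesis
        unfolding char_def by (subst (1 2) integral_distr) auto
    qed
    moreover have "(\<lambda>n. char (distr M borel (partial c n)) t) \<longlonglongrightarrow> exp (- v * t\<^sup>2 / 2)"
      unfolding char_partial using c unfolding sums_def by (intro tendsto_intros) auto
    ultimately have "char (distr M borel (\<lambda>\<omega>. \<Sum>i. c i * \<xi> i \<omega>)) t = exp (- v * t\<^sup>2 / 2)"
      by (rule LIMSEQ_unique)
    then show "char (distr M borel (\<lambda>\<omega>. \<Sum>i. c i * \<xi> i \<omega>)) t = char (normal_law 0 v) t"
      using v by (simp add: char_normal_law)
  qed
qed

lemma series_second_moment:
  assumes c: "(\<lambda>i. (c i)\<^sup>2) sums v" and conv: "AE \<omega> in M. summable (\<lambda>i. c i * \<xi> i \<omega>)"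
  shows "integrable M (\<lambda>\<omega>. (\<Sum>i. c i * \<xi> i \<omega>)\<^sup>2)"
    and "expectation (\<lambda>\<omega>. (\<Sum>i. c i * \<xi> i \<omega>)\<^sup>2) = v"
proof -
  have v: "v \<ge> 0"
    using sums_le[OF _ sums_zero c] by simp
  let ?D = "distr M borel (\<lambda>\<omega>. \<Sum>i. c i * \<xi> i \<omega>)"
  have "integrable ?D (\<lambda>x. x\<^sup>2)" "(LINT x|?D. x\<^sup>2) = v"
    unfolding distr_series[OF c conv] using v by (rule second_moment_normal_law)+
  then show "integrable M (\<lambda>\<omega>. (\<Sum>i. c i * \<xi> i \<omega>)\<^sup>2)"
      "expectation (\<lambda>\<omega>. (\<Sum>i. c i * \<xi> i \<omega>)\<^sup>2) = v"
    by (simp_all add: integrable_distr_eq integral_distr)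
qed

text \<open>
  The remainder after \<open>n\<close> terms is itself a series of the same kind, with the first \<open>n\<close> coefficients
  set to 0, so its \<open>L\<^sup>2\<close> norm is known exactly from its law.
\<close>

lemma series_L2_tendsto:
  assumes c: "(\<lambda>i. (c i)\<^sup>2) sums v" and conv: "AE \<omega> in M. summable (\<lambda>i. c i * \<xi> i \<omega>)"
  shows "L2_tendsto M (partial c) (\<lambda>\<omega>. \<Sum>i. c i * \<xi> i \<omega>)"
  unfolding L2_tendsto_def
proof (intro conjI allI)
  show "partial c n \<in> L2_functions M" for n
    unfolding L2_functions_def using partial_power_integrable[of c n 2] by auto
  show "(\<lambda>\<omega>. \<Sum>i. c i * \<xi> i \<omega>) \<in> L2_functions M"
    unfolding L2_functions_def using series_second_moment[OF c conv] by auto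
  have "L2_norm M (\<lambda>\<omega>. partial c n \<omega> - (\<Sum>i. c i * \<xi> i \<omega>)) = sqrt (v - (\<Sum>i<n. (c i)\<^sup>2))" for n
  proof -
    let ?d = "\<lambda>i. if i < n then 0 else c i"
    have d: "?d i = c i - (if i \<in> {..<n} then c i else 0)"
      and d2: "(?d i)\<^sup>2 = (c i)\<^sup>2 - (if i \<in> {..<n} then (c i)\<^sup>2 else 0)" for i by auto
    have d_sums: "(\<lambda>i. (?d i)\<^sup>2) sums (v - (\<Sum>i<n. (c i)\<^sup>2))"
      unfolding d2 by (intro sums_diff c sums_If_finite_set) auto
    have tail: "(\<lambda>i. ?d i * \<xi> i \<omega>) sums ((\<Sum>i. c i * \<xi> i \<omega>) - partial c n \<omega>)"
      if "summable (\<lambda>i. c i * \<xi> i \<omega>)" for \<omega>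
    proof -
      have "(\<lambda>i. c i * \<xi> i \<omega> - (if i \<in> {..<n} then c i * \<xi> i \<omega> else 0)) sums ((\<Sum>i. c i * \<xi> i \<omega>) - partial c n \<omega>)"
        by (intro sums_diff summable_sums that sums_If_finite_set) auto
      also have "(\<lambda>i. c i * \<xi> i \<omega> - (if i \<in> {..<n} then c i * \<xi> i \<omega> else 0)) = (\<lambda>i. ?d i * \<xi> i \<omega>)"
        by auto
      finally show ?thesis .
    qed
    have d_conv: "AE \<omega> in M. summable (\<lambda>i. ?d i * \<xi> i \<omega>)"
      using conv by eventually_elim (rule sums_summable[OF tail])
    have "expectation (\<lambda>\<omega>. (partial c n \<omega> - (\<Sum>i. c i * \<xi> i \<omega>))\<^sup>2) = expectation (\<lambda>\<omega>. (\<Sum>i. ?d i * \<xi> i \<omega>)\<^sup>2)"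
    proof (rule integral_cong_AE)
      show "AE \<omega> in M. (partial c n \<omega> - (\<Sum>i. c i * \<xi> i \<omega>))\<^sup>2 = (\<Sum>i. ?d i * \<xi> i \<omega>)\<^sup>2"
        using conv by eventually_elim (simp add: sums_unique[OF tail, symmetric] power2_commute)
    qed measurable
    also have "\<dots> = v - (\<Sum>i<n. (c i)\<^sup>2)"
      by (rule series_second_moment[OF d_sums d_conv])
    finally show ?thesis
      by (simp add: L2_norm_def L2_inner_def power2_eq_square)
  qed
  moreover have "(\<lambda>n. sqrt (v - (\<Sum>i<n. (c i)\<^sup>2))) \<longlonglongrightarrow> sqrt (v - v)"
    using c unfolding sums_def by (intro tendsto_intros)
  ultimately show "(\<lambda>n. L2_norm M (\<lambda>\<omega>. partial c n \<omega> - (\<Sum>i. c i * \<xi> i \<omega>))) \<longlonglongrightarrow> 0"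
    by simp
qed

end

section \<open>Uniform convergence by dyadic chaining\<close>

text \<open>
  Rounding \<open>u\<close> down to the dyadic grids of levels 0, 1, 2, ... gives a sequence that converges to \<open>u\<close>
  and moves by at most one interval of the finer grid from one level to the next.
\<close>

lemma dyadic_chaining:
  fixes h :: "real \<Rightarrow> real"
  assumes cont: "continuous_on {0..1} h"
    and incr: "\<And>j k :: nat. k < 2 ^ j \<Longrightarrow> \<bar>h ((real k + 1) / 2 ^ j) - h (real k / 2 ^ j)\<bar> \<le> x j"
    and x: "summable x" and u: "u \<in> {0..1}"
  shows "\<bar>h u - h 0\<bar> \<le> suminf x"
proof -
  have x0: "x j \<ge> 0" for j
    using incr[of 0 j] abs_ge_zero order_trans by fastforce
  define K where "K j = nat \<lfloor>u * 2 ^ j\<rfloor>" for j :: nat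
  have K: "real (K j) \<le> u * 2 ^ j" "u * 2 ^ j < real (K j) + 1" for j
  proof -
    have "0 \<le> u * 2 ^ j" using u by simp
    then show "real (K j) \<le> u * 2 ^ j" "u * 2 ^ j < real (K j) + 1"
      unfolding K_def by linarith+
  qed
  have Kle: "real (K j) \<le> 2 ^ j" for j
  proof -
    have "u * 2 ^ j \<le> 1 * 2 ^ j" using u by (intro mult_right_mono) auto
    then show ?thesis using K(1)[of j] by linarith
  qed
  have Ksuc: "K (Suc j) = 2 * K j \<or> K (Suc j) = 2 * K j + 1" for j
    using K[of j] K[of "Suc j"] by (simp add: algebra_simps) linarith
  define D where "D j = real (K j) / 2 ^ j" for j
  have bound: "\<bar>h (D j) - h 0\<bar> \<le> (\<Sum>i\<le>j. x i)" for j
  proof (induction j)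
    case 0
    have "K 0 \<le> 1" using Kle[of 0] by simp
    then have "K 0 = 0 \<or> K 0 = 1" by linarith
    then show ?case
      using incr[of 0 0] x0[of 0] by (auto simp: D_def)
  next
    case (Suc j)
    have "\<bar>h (D (Suc j)) - h (D j)\<bar> \<le> x (Suc j)"
    proof (cases "K (Suc j) = 2 * K j")
      case True
      then have "D (Suc j) = D j" by (simp add: D_def)
      then show ?thesis using x0 by simp
    next
      case False
      then have eq: "K (Suc j) = 2 * K j + 1" using Ksuc[of j] by simp
      have "K (Suc j) \<le> 2 ^ Suc j"
        using Kle[of "Suc j"] by (simp del: power_Suc)
      then have lt: "2 * K j < 2 ^ Suc j"
        unfolding eq by simp
      have "D (Suc j) = (real (2 * K j) + 1) / 2 ^ Suc j" "D j = real (2 * K j) / 2 ^ Suc j"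
        by (simp_all add: D_def eq)
      then show ?thesis using incr[OF lt] by simp
    qed
    then show ?case using Suc by simp
  qed
  have "D \<longlonglongrightarrow> u"
  proof (rule tendsto_sandwich[of "\<lambda>j. u - 1 / 2 ^ j" _ _ "\<lambda>j. u"])
    have "u \<le> (real (K j) + 1) / 2 ^ j" for j
      using less_imp_le[OF K(2)] by (simp add: pos_le_divide_eq)
    then show "\<forall>\<^sub>F j in sequentially. u - 1 / 2 ^ j \<le> D j"
      by (intro always_eventually allI) (simp add: D_def add_divide_distrib diff_le_eq)
    show "\<forall>\<^sub>F j in sequentially. D j \<le> u"
      using K(1) by (intro always_eventually allI) (simp add: D_def field_simps)
    have "(\<lambda>j. u - (1 / 2) ^ j) \<longlonglongrightarrow> u - 0"
      by (intro tendsto_intros LIMSEQ_power_zero) simp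
    then show "(\<lambda>j. u - 1 / 2 ^ j) \<longlonglongrightarrow> u"
      by (simp add: power_one_over)
  qed simp
  then have "(\<lambda>j. h (D j)) \<longlonglongrightarrow> h u"
  proof (rule continuous_on_tendsto_compose[OF cont _ u])
    show "\<forall>\<^sub>F j in sequentially. D j \<in> {0..1}"
      using Kle by (intro always_eventually allI) (simp add: D_def)
  qed
  then have "(\<lambda>j. \<bar>h (D j) - h 0\<bar>) \<longlonglongrightarrow> \<bar>h u - h 0\<bar>"
    by (intro tendsto_intros)
  moreover have "\<bar>h (D j) - h 0\<bar> \<le> suminf x" for j
    using bound[of j] sum_le_suminf[OF x, of "{..j}"] x0 by force
  ultimately show ?thesis
    by (intro LIMSEQ_le_const2) auto
qed

context gaussian_sequence
begin

text \<open>
  The bound on the increments of the coefficients says that the series, at each pair of times, has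
  increments of variance at most \<open>R * \<bar>u - v\<bar>\<close>, as for Brownian motion.
\<close>

lemma series_paths_continuous:
  fixes c :: "nat \<Rightarrow> real \<Rightarrow> real"
  assumes c0: "\<And>i. c i 0 = 0"
    and sm: "\<And>u v. u \<in> {0..1} \<Longrightarrow> v \<in> {0..1} \<Longrightarrow> summable (\<lambda>i. (c i u - c i v)\<^sup>2)"
    and le: "\<And>u v. u \<in> {0..1} \<Longrightarrow> v \<in> {0..1} \<Longrightarrow> (\<Sum>i. (c i u - c i v)\<^sup>2) \<le> R * \<bar>u - v\<bar>"
  shows "AE \<omega> in M. (\<forall>u\<in>{0..1}. summable (\<lambda>i. c i u * \<xi> i \<omega>)) \<and>
    continuous_on {0..1} (\<lambda>u. \<Sum>i. c i u * \<xi> i \<omega>)"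
proof -
  have cont: "continuous_on {0..1} (c i)" for i
    unfolding continuous_on_def
  proof
    fix v :: real assume v: "v \<in> {0..1}"
    have "((\<lambda>u. (c i u - c i v)\<^sup>2) \<longlongrightarrow> 0) (at v within {0..1})"
    proof (rule tendsto_sandwich[of "\<lambda>_. 0" _ _ "\<lambda>u. R * \<bar>u - v\<bar>"])
      have "(c i u - c i v)\<^sup>2 \<le> R * \<bar>u - v\<bar>" if "u \<in> {0..1}" for u
        using sum_le_suminf[OF sm[OF that v], of "{i}"] le[OF that v] by simp
      then show "\<forall>\<^sub>F u in at v within {0..1}. (c i u - c i v)\<^sup>2 \<le> R * \<bar>u - v\<bar>"
        by (auto simp: eventually_at_filter)
      have "((\<lambda>u. R * \<bar>u - v\<bar>) \<longlongrightarrow> R * \<bar>v - v\<bar>) (at v within {0..1})"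
        by (intro tendsto_intros)
      then show "((\<lambda>u. R * \<bar>u - v\<bar>) \<longlongrightarrow> 0) (at v within {0..1})" by simp
    qed auto
    then have "((\<lambda>u. sqrt ((c i u - c i v)\<^sup>2)) \<longlongrightarrow> sqrt 0) (at v within {0..1})"
      by (rule tendsto_real_sqrt)
    then show "(c i \<longlongrightarrow> c i v) (at v within {0..1})"
      by (simp add: tendsto_rabs_zero_iff LIM_zero_iff)
  qed
  \<comment> \<open>\<open>d j k i\<close> is the increment of the \<open>i\<close>-th coefficient over the \<open>k\<close>-th dyadic interval of level \<open>j\<close>,
    and \<open>V m j k\<close> the variance of the increment of the series from index \<open>m\<close> on.\<close>
  define d where "d j k i = c i ((real k + 1) / 2 ^ j) - c i (real k / 2 ^ j)" for j k i :: nat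
  have pts: "(real k + 1) / 2 ^ j \<in> {0..1}" "real k / 2 ^ j \<in> {0..1}" if "k < 2 ^ j" for j k :: nat
  proof -
    have "real k + 1 \<le> 2 ^ j"
      using that by (metis Suc_leI of_nat_Suc of_nat_le_iff of_nat_numeral of_nat_power add.commute)
    then show "(real k + 1) / 2 ^ j \<in> {0..1}" "real k / 2 ^ j \<in> {0..1}"
      using that by auto
  qed
  have d_sm: "summable (\<lambda>i. (d j k i)\<^sup>2)" and d_le: "(\<Sum>i. (d j k i)\<^sup>2) \<le> R / 2 ^ j" if "k < 2 ^ j" for j k
  proof -
    show "summable (\<lambda>i. (d j k i)\<^sup>2)"
      unfolding d_def by (rule sm[OF pts[OF that]])
    have "(real k + 1) / 2 ^ j - real k / 2 ^ j = 1 / 2 ^ j"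
      by (simp add: field_simps)
    then show "(\<Sum>i. (d j k i)\<^sup>2) \<le> R / 2 ^ j"
      using le[OF pts[OF that]] by (simp add: d_def)
  qed
  define V where "V m j k = (\<Sum>i. (d j k i)\<^sup>2) - (\<Sum>i<m. (d j k i)\<^sup>2)" for m j k :: nat
  have tail: "(\<lambda>i. (if i < m then 0 else d j k i)\<^sup>2) sums V m j k" if "k < 2 ^ j" for m j k
  proof -
    have "(\<lambda>i. (d j k i)\<^sup>2 - (if i \<in> {..<m} then (d j k i)\<^sup>2 else 0)) sums V m j k"
      unfolding V_def by (intro sums_diff summable_sums d_sm that sums_If_finite_set) auto
    also have "(\<lambda>i. (d j k i)\<^sup>2 - (if i \<in> {..<m} then (d j k i)\<^sup>2 else 0)) = (\<lambda>i. (if i < m then 0 else d j k i)\<^sup>2)"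
      by auto
    finally show ?thesis .
  qed
  have V0: "0 \<le> V m j k" and Vle: "V m j k \<le> R / 2 ^ j" if "k < 2 ^ j" for m j k
  proof -
    show "0 \<le> V m j k" using sums_le[OF _ sums_zero tail[OF that]] by simp
    have "0 \<le> (\<Sum>i<m. (d j k i)\<^sup>2)" by (intro sum_nonneg) simp
    then show "V m j k \<le> R / 2 ^ j" using d_le[OF that] by (simp add: V_def)
  qed
  have Vlim: "(\<lambda>m. V m j k) \<longlonglongrightarrow> 0" if "k < 2 ^ j" for j k
  proof -
    have "(\<lambda>m. V m j k) \<longlonglongrightarrow> (\<Sum>i. (d j k i)\<^sup>2) - (\<Sum>i. (d j k i)\<^sup>2)"
      unfolding V_def by (intro tendsto_intros summable_LIMSEQ d_sm that)
    then show ?thesis by simp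
  qed
  \<comment> \<open>Any \<open>q < 1\<close> with \<open>2 * q ^ 4 > 1\<close> makes both the thresholds and the probability bounds summable.\<close>
  define q :: real where "q = 9 / 10"
  define E where "E \<epsilon> m j k = {\<omega> \<in> space M. \<exists>n. \<epsilon> * q ^ j \<le> \<bar>partial (\<lambda>i. if i < m then 0 else d j k i) n \<omega>\<bar>}"
    for \<epsilon> m j k
  \<comment> \<open>Setting the coefficients before \<open>m\<close> to 0 makes \<open>partial\<close> the block of the series from \<open>m\<close> to \<open>n\<close>.\<close>
  define Bad where "Bad \<epsilon> m = (\<Union>j. \<Union>k<2 ^ j. E \<epsilon> m j k)" for \<epsilon> m
  have E_sets[measurable]: "E \<epsilon> m j k \<in> sets M" for \<epsilon> m j k
    unfolding E_def by measurable
  have Bad_sets[measurable]: "Bad \<epsilon> m \<in> sets M" for \<epsilon> m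
    unfolding Bad_def by (intro sets.countable_UN sets.finite_UN) auto
  have Bad_lim: "(\<lambda>m. prob (Bad \<epsilon> m)) \<longlonglongrightarrow> 0" if \<epsilon>: "\<epsilon> > 0" for \<epsilon>
  proof -
    define w where "w j m = (\<Sum>k<2 ^ j. 3 * (V m j k)\<^sup>2 / (\<epsilon> * q ^ j) ^ 4)" for j m :: nat
    have w0: "0 \<le> w j m" for j m
      unfolding w_def by (intro sum_nonneg) (simp add: q_def)
    \<comment> \<open>There are \<open>2 ^ j\<close> intervals, each contributing a variance of order \<open>2 ^ (- j)\<close>, squared.\<close>
    have wle: "w j m \<le> 3 * R\<^sup>2 / \<epsilon> ^ 4 * (1 / (2 * q ^ 4)) ^ j" for j m
    proof -
      have "w j m \<le> (\<Sum>k<(2::nat) ^ j. 3 * (R / 2 ^ j)\<^sup>2 / (\<epsilon> * q ^ j) ^ 4)"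
        unfolding w_def using V0 Vle
        by (intro sum_mono divide_right_mono mult_left_mono power_mono) auto
      also have "\<dots> = 3 * R\<^sup>2 / \<epsilon> ^ 4 * (1 / (2 * q ^ 4)) ^ j"
      proof -
        have "(q ^ 4) ^ j = (q ^ j) ^ 4" by (simp flip: power_mult add: mult.commute)
        then show ?thesis
          by (simp add: power_mult_distrib power_divide power2_eq_square[of "2 ^ j"])
      qed
      finally show ?thesis .
    qed
    have prob_w: "prob (\<Union>k<2 ^ j. E \<epsilon> m j k) \<le> w j m" for j m
    proof -
      have "prob (\<Union>k<2 ^ j. E \<epsilon> m j k) \<le> (\<Sum>k<2 ^ j. prob (E \<epsilon> m j k))"
        by (intro finite_measure_subadditive_finite) auto
      also have "\<dots> \<le> w j m"
        unfolding w_def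
      proof (rule sum_mono)
        fix k :: nat assume "k \<in> {..<2 ^ j}"
        then have k: "k < 2 ^ j" by simp
        have "0 < \<epsilon> * q ^ j" using \<epsilon> by (simp add: q_def)
        from maximal_inequality[OF this sums_summable[OF tail[OF k]]]
        show "prob (E \<epsilon> m j k) \<le> 3 * (V m j k)\<^sup>2 / (\<epsilon> * q ^ j) ^ 4"
          unfolding E_def sums_unique[OF tail[OF k], symmetric] .
      qed
      finally show ?thesis .
    qed
    have geo: "summable (\<lambda>j. 3 * R\<^sup>2 / \<epsilon> ^ 4 * (1 / (2 * q ^ 4)) ^ j)"
      by (intro summable_mult summable_geometric) (simp add: q_def power4_eq_xxxx)
    have sw: "summable (\<lambda>j. w j m)" for m
      by (rule summable_comparison_test'[OF geo, of 0]) (use w0 wle in auto)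
    have prob_Bad: "prob (Bad \<epsilon> m) \<le> (\<Sum>j. w j m)" for m
    proof -
      have s: "summable (\<lambda>j. prob (\<Union>k<2 ^ j. E \<epsilon> m j k))"
        by (rule summable_comparison_test'[OF sw, of 0]) (use prob_w in auto)
      have "prob (Bad \<epsilon> m) \<le> (\<Sum>j. prob (\<Union>k<2 ^ j. E \<epsilon> m j k))"
        unfolding Bad_def by (intro finite_measure_subadditive_countably s) auto
      also have "\<dots> \<le> (\<Sum>j. w j m)"
        by (intro suminf_le prob_w s sw)
      finally show ?thesis .
    qed
    have wlim: "w j \<longlonglongrightarrow> 0" for j
    proof -
      have "w j \<longlonglongrightarrow> (\<Sum>k<(2::nat) ^ j. 3 * 0\<^sup>2 / (\<epsilon> * q ^ j) ^ 4)"
        unfolding w_def using \<epsilon> by (intro tendsto_intros Vlim) (auto simp: q_def)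
      then show ?thesis by simp
    qed
    have "\<forall>\<^sub>F (j, m) in sequentially \<times>\<^sub>F sequentially.
        norm (w j m) \<le> 3 * R\<^sup>2 / \<epsilon> ^ 4 * (1 / (2 * q ^ 4)) ^ j"
      using w0 wle by (intro always_eventually) (simp add: case_prod_beta)
    then have "(\<lambda>m. \<Sum>j. w j m) \<longlonglongrightarrow> suminf (\<lambda>j. 0)"
      using tannerys_theorem[of w "\<lambda>_. 0", OF wlim _ geo] by simp
    then have "(\<lambda>m. \<Sum>j. w j m) \<longlonglongrightarrow> 0" by simp
    then show ?thesis
      by (rule tendsto_sandwich[rotated 3]) (auto simp: prob_Bad)
  qed
  have good: "AE \<omega> in M. \<exists>m. \<omega> \<notin> Bad \<epsilon> m" if \<epsilon>: "\<epsilon> > 0" for \<epsilon>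
  proof (rule AE_I)
    show "{\<omega> \<in> space M. \<not> (\<exists>m. \<omega> \<notin> Bad \<epsilon> m)} \<subseteq> (\<Inter>m. Bad \<epsilon> m)" by auto
    show N: "(\<Inter>m. Bad \<epsilon> m) \<in> sets M" by auto
    have "prob (\<Inter>m. Bad \<epsilon> m) \<le> prob (Bad \<epsilon> m)" for m
      by (intro finite_measure_mono) auto
    then have "prob (\<Inter>m. Bad \<epsilon> m) \<le> 0"
      by (intro LIMSEQ_le_const[OF Bad_lim[OF \<epsilon>]]) auto
    then show "emeasure M (\<Inter>m. Bad \<epsilon> m) = 0"
      by (simp add: emeasure_eq_measure measure_le_0_iff)
  qed
  have "AE \<omega> in M. \<forall>l::nat. \<exists>m. \<omega> \<notin> Bad (1 / real (Suc l)) m"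
    unfolding AE_all_countable by (intro allI good) simp
  then show ?thesis
  proof (rule AE_mp, intro AE_I2 impI)
    fix \<omega> assume \<omega>: "\<omega> \<in> space M" and g: "\<forall>l::nat. \<exists>m. \<omega> \<notin> Bad (1 / real (Suc l)) m"
    define S where "S n u = (\<Sum>i<n. c i u * \<xi> i \<omega>)" for n u
    have osc: "\<bar>S n u - S m u\<bar> \<le> 10 * \<epsilon>"
      if nb: "\<omega> \<notin> Bad \<epsilon> m" and n: "n \<ge> m" and u: "u \<in> {0..1}" for \<epsilon> m n u
    proof -
      define h where "h u = (\<Sum>i<n. (if i < m then 0 else c i u) * \<xi> i \<omega>)" for u
      have h_eq: "h u = S n u - S m u" for u
      proof -
        have "S n u = (\<Sum>i<m. c i u * \<xi> i \<omega>) + (\<Sum>i=m..<n. c i u * \<xi> i \<omega>)"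
          unfolding S_def using n by (simp add: lessThan_atLeast0 sum.atLeastLessThan_concat)
        moreover have "h u = (\<Sum>i=m..<n. c i u * \<xi> i \<omega>)"
          unfolding h_def by (rule sum.mono_neutral_cong_right) auto
        ultimately show ?thesis by (simp add: S_def)
      qed
      have "\<bar>h u - h 0\<bar> \<le> (\<Sum>j. \<epsilon> * q ^ j)"
      proof (rule dyadic_chaining[OF _ _ _ u])
        show "continuous_on {0..1} h"
          unfolding h_eq S_def by (intro continuous_intros cont)
        show "summable (\<lambda>j. \<epsilon> * q ^ j)"
          by (intro summable_mult summable_geometric) (simp add: q_def)
        fix j k :: nat assume k: "k < 2 ^ j"
        have "h ((real k + 1) / 2 ^ j) - h (real k / 2 ^ j) = partial (\<lambda>i. if i < m then 0 else d j k i) n \<omega>"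
          unfolding h_def d_def by (simp add: sum_subtractf[symmetric] algebra_simps cong: if_cong) 
            (intro sum.cong; simp add: algebra_simps)
        moreover have "\<omega> \<notin> E \<epsilon> m j k"
          using nb k by (auto simp: Bad_def)
        ultimately show "\<bar>h ((real k + 1) / 2 ^ j) - h (real k / 2 ^ j)\<bar> \<le> \<epsilon> * q ^ j"
          using \<omega> by (auto simp: E_def not_le less_imp_le)
      qed
      also have "(\<Sum>j. \<epsilon> * q ^ j) = 10 * \<epsilon>"
        by (subst suminf_mult) (auto simp: suminf_geometric summable_geometric q_def)
      finally show ?thesis by (simp add: h_eq) (simp add: S_def c0)
    qed
    have "uniformly_convergent_on {0..1} S"
    proof (intro Cauchy_uniformly_convergent uniformly_Cauchy_onI)
      fix e :: real assume e: "e > 0"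
      then obtain l where l: "1 / real (Suc l) < e / 20"
        using reals_Archimedean[of "e / 20"] by (auto simp: inverse_eq_divide)
      obtain m where m: "\<omega> \<notin> Bad (1 / real (Suc l)) m" using g by blast
      have "dist (S n u) (S n' u) < e" if "u \<in> {0..1}" "n \<ge> m" "n' \<ge> m" for u n n'
        using osc[OF m that(2,1)] osc[OF m that(3,1)] l by (simp add: dist_real_def)
      then show "\<exists>m. \<forall>u\<in>{0..1}. \<forall>n\<ge>m. \<forall>n'\<ge>m. dist (S n u) (S n' u) < e" by blast
    qed
    then have lim: "uniform_limit {0..1} S (\<lambda>u. lim (\<lambda>n. S n u)) sequentially"
      by (simp only: uniformly_convergent_uniform_limit_iff)
    have sums: "(\<lambda>i. c i u * \<xi> i \<omega>) sums lim (\<lambda>n. S n u)" if "u \<in> {0..1}" for u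
      using tendsto_uniform_limitI[OF lim that] unfolding sums_def S_def .
    have "continuous_on {0..1} (\<lambda>u. lim (\<lambda>n. S n u))"
      by (rule uniform_limit_theorem[OF _ lim])
        (auto simp: S_def intro!: always_eventually continuous_intros cont)
    then have "continuous_on {0..1} (\<lambda>u. \<Sum>i. c i u * \<xi> i \<omega>)"
      by (rule continuous_on_cong[THEN iffD1, rotated 2]) (auto simp: sums_unique[OF sums])
    then show "(\<forall>u\<in>{0..1}. summable (\<lambda>i. c i u * \<xi> i \<omega>)) \<and>
        continuous_on {0..1} (\<lambda>u. \<Sum>i. c i u * \<xi> i \<omega>)"
      using sums sums_summable by blast
  qed
qed

end

section \<open>The process defined by the series\<close>

locale gaussian_stieltjes_series = gaussian_sequence M \<xi>
  for M :: "'w measure" and \<xi> :: "nat \<Rightarrow> 'w \<Rightarrow> real" +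
  fixes a b :: real and \<rho> :: "real \<Rightarrow> real" and \<phi> :: "nat \<Rightarrow> real \<Rightarrow> real"
  assumes ab: "a < b" and cont: "continuous_on {a..b} \<rho>" and mono: "mono_on {a..b} \<rho>"
    and basis: "L2_orthonormal_basis (stieltjes_measure a b \<rho>) \<phi>"
begin

abbreviation \<mu> :: "real measure" where "\<mu> \<equiv> stieltjes_measure a b \<rho>"

abbreviation coef :: "nat \<Rightarrow> real \<Rightarrow> real" where
  "coef n t \<equiv> stieltjes_primitive a b \<rho> (\<phi> n) t"

abbreviation X :: "real \<Rightarrow> 'w \<Rightarrow> real" where
  "X t \<omega> \<equiv> \<Sum>n. coef n t * \<xi> n \<omega>"

lemma phi_L2: "\<phi> n \<in> L2_functions \<mu>"
  using basis by (simp add: L2_orthonormal_basis_def)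

lemma rho_mono: "a \<le> s \<Longrightarrow> s \<le> t \<Longrightarrow> t \<le> b \<Longrightarrow> \<rho> s \<le> \<rho> t"
  by (intro monotone_onD[OF mono]) auto

lemma combination_sums:
  assumes I: "finite I" and st: "\<And>i. i \<in> I \<Longrightarrow> a \<le> s i \<and> s i \<le> t i \<and> t i \<le> b"
    and disj: "\<And>i j. i \<in> I \<Longrightarrow> j \<in> I \<Longrightarrow> i \<noteq> j \<Longrightarrow> {s i<..t i} \<inter> {s j<..t j} = {}"
  shows "(\<lambda>n. (\<Sum>i\<in>I. u i * (coef n (t i) - coef n (s i)))\<^sup>2) sums (\<Sum>i\<in>I. (u i)\<^sup>2 * (\<rho> (t i) - \<rho> (s i)))"
proof -
  let ?h = "\<lambda>i. indicator {s i<..t i} :: real \<Rightarrow> real"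
  note ind = stieltjes_indicator[OF cont mono]
  have h: "?h i \<in> L2_functions \<mu>" if "i \<in> I" for i
    using st[OF that] by (intro ind(1)) auto
  have orth: "L2_inner \<mu> (?h i) (?h j) = 0" if "i \<in> I" "j \<in> I" "i \<noteq> j" for i j
  proof -
    have "(\<lambda>x. ?h i x * ?h j x) = (\<lambda>x. 0)"
      using disj[OF that] by (auto simp: indicator_def fun_eq_iff)
    then show ?thesis by (simp add: L2_inner_def)
  qed
  have "(\<lambda>n. (L2_inner \<mu> (\<phi> n) (\<lambda>x. \<Sum>i\<in>I. u i * ?h i x))\<^sup>2) sums
      L2_inner \<mu> (\<lambda>x. \<Sum>i\<in>I. u i * ?h i x) (\<lambda>x. \<Sum>i\<in>I. u i * ?h i x)"
    by (intro parseval basis L2_sum h)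
  also have "L2_inner \<mu> (\<lambda>x. \<Sum>i\<in>I. u i * ?h i x) (\<lambda>x. \<Sum>i\<in>I. u i * ?h i x)
      = (\<Sum>i\<in>I. (u i)\<^sup>2 * (\<rho> (t i) - \<rho> (s i)))"
    using st by (subst L2_inner_sum_both[OF I h orth]) (auto intro!: sum.cong ind(2))
  also have "(\<lambda>n. L2_inner \<mu> (\<phi> n) (\<lambda>x. \<Sum>i\<in>I. u i * ?h i x))
      = (\<lambda>n. \<Sum>i\<in>I. u i * (coef n (t i) - coef n (s i)))"
  proof
    fix n
    have "L2_inner \<mu> (\<phi> n) (\<lambda>x. \<Sum>i\<in>I. u i * ?h i x) = (\<Sum>i\<in>I. u i * L2_inner \<mu> (\<phi> n) (?h i))"
      by (rule L2_inner_sum_right[OF phi_L2 h])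
    also have "\<dots> = (\<Sum>i\<in>I. u i * (coef n (t i) - coef n (s i)))"
      using st ind(3)[OF _ _ _ phi_L2] by (intro sum.cong) auto
    finally show "L2_inner \<mu> (\<phi> n) (\<lambda>x. \<Sum>i\<in>I. u i * ?h i x)
        = (\<Sum>i\<in>I. u i * (coef n (t i) - coef n (s i)))" .
  qed
  finally show ?thesis .
qed

lemma increment_sums:
  assumes "s \<in> {a..b}" "t \<in> {a..b}"
  shows "(\<lambda>n. (coef n t - coef n s)\<^sup>2) sums \<bar>\<rho> t - \<rho> s\<bar>"
proof -
  have *: "(\<lambda>n. (coef n t - coef n s)\<^sup>2) sums \<bar>\<rho> t - \<rho> s\<bar>" if "a \<le> s" "s \<le> t" "t \<le> b" for s t
    using combination_sums[of "{()}" "\<lambda>_. s" "\<lambda>_. t" "\<lambda>_. 1"] that rho_mono[OF that] by simp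
  show ?thesis
    using *[of s t] *[of t s] assms by (cases "s \<le> t") (auto simp: power2_commute abs_minus_commute)
qed

lemma coef_left: "coef n a = 0"
  using ab by (intro stieltjes_primitive_left cont mono) auto

text \<open>
  The measure is not zero, because it admits a normalized function \<open>\<phi> 0\<close>.
\<close>

lemma rho_less: "\<rho> a < \<rho> b"
proof (rule ccontr)
  assume "\<not> \<rho> a < \<rho> b"
  then have "{a..b} \<in> null_sets \<mu>"
    using emeasure_stieltjes_interval[OF cont mono, of a b] ab by (auto simp: null_sets_def ennreal_neg)
  then have "AE x in \<mu>. x \<notin> {a..b}" by (rule AE_not_in)
  moreover have "AE x in \<mu>. x \<in> {a..b}"
    by (rule AE_I2) (auto simp: stieltjes_measure_def space_restrict_space)
  ultimately have "AE x in \<mu>. \<phi> 0 x * \<phi> 0 x = 0" by eventually_elim simp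
  then have "L2_inner \<mu> (\<phi> 0) (\<phi> 0) = 0"
    unfolding L2_inner_def by (rule integral_eq_zero_AE)
  then show False using basis by (simp add: L2_orthonormal_basis_def)
qed

text \<open>
  The time change that makes the variance linear: \<open>\<gamma>\<close> is a right inverse of the clock. It need not be
  continuous, since the coefficients depend on \<open>t\<close> only through \<open>\<rho> t\<close>.
\<close>

lemma almost_all_paths:
  "AE \<omega> in M. (\<forall>t\<in>{a..b}. summable (\<lambda>n. coef n t * \<xi> n \<omega>)) \<and> continuous_on {a..b} (\<lambda>t. X t \<omega>)"
proof -
  define R where "R = \<rho> b - \<rho> a"
  have R: "R > 0" using rho_less by (simp add: R_def)
  have "\<exists>t\<in>{a..b}. \<rho> t = \<rho> a + u * R" if "u \<in> {0..1}" for u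
  proof -
    have "0 \<le> u * R" "u * R \<le> 1 * R"
      using that R by (auto intro!: mult_right_mono)
    then have "\<rho> a \<le> \<rho> a + u * R" "\<rho> a + u * R \<le> \<rho> b"
      by (simp_all add: R_def)
    then show ?thesis
      using IVT'[of \<rho> a "\<rho> a + u * R" b] cont ab by auto
  qed
  then obtain \<gamma> where \<gamma>: "\<And>u. u \<in> {0..1} \<Longrightarrow> \<gamma> u \<in> {a..b}" "\<And>u. u \<in> {0..1} \<Longrightarrow> \<rho> (\<gamma> u) = \<rho> a + u * R"
    by metis
  define clock where "clock t = (\<rho> t - \<rho> a) / R" for t
  have clock: "clock t \<in> {0..1}" if "t \<in> {a..b}" for t
    using that R rho_mono[of a t] rho_mono[of t b] by (auto simp: clock_def R_def)
  have coef_eq: "coef n s = coef n t" if "s \<in> {a..b}" "t \<in> {a..b}" "\<rho> s = \<rho> t" for n s t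
  proof -
    have "(\<lambda>n. (coef n t - coef n s)\<^sup>2) sums 0"
      using increment_sums[OF that(1,2)] that(3) by simp
    then have "(coef n t - coef n s)\<^sup>2 \<le> 0"
      using sum_le_suminf[of "\<lambda>n. (coef n t - coef n s)\<^sup>2" "{n}"] by (simp add: sums_iff)
    then show ?thesis by simp
  qed
  have reparam: "coef n (\<gamma> (clock t)) = coef n t" if "t \<in> {a..b}" for n t
    using that \<gamma>[OF clock[OF that]] R by (intro coef_eq) (auto simp: clock_def)
  have sums: "(\<lambda>n. (coef n (\<gamma> u) - coef n (\<gamma> v))\<^sup>2) sums (R * \<bar>u - v\<bar>)"
    if "u \<in> {0..1}" "v \<in> {0..1}" for u v
  proof -
    have "\<rho> (\<gamma> u) - \<rho> (\<gamma> v) = R * (u - v)"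
      using \<gamma>(2) that by (simp add: algebra_simps)
    then show ?thesis
      using increment_sums[OF \<gamma>(1)[OF that(2)] \<gamma>(1)[OF that(1)]] R by (simp add: abs_mult)
  qed
  have "coef n (\<gamma> 0) = 0" for n
    using coef_eq[of "\<gamma> 0" a n] \<gamma>[of 0] ab by (simp add: coef_left)
  then have "AE \<omega> in M. (\<forall>u\<in>{0..1}. summable (\<lambda>n. coef n (\<gamma> u) * \<xi> n \<omega>)) \<and>
      continuous_on {0..1} (\<lambda>u. \<Sum>n. coef n (\<gamma> u) * \<xi> n \<omega>)"
    using sums by (intro series_paths_continuous[where R=R]) (auto simp: sums_iff)
  then show ?thesis
  proof eventually_elim
    case (elim \<omega>)
    have "continuous_on {a..b} (\<lambda>t. \<Sum>n. coef n (\<gamma> (clock t)) * \<xi> n \<omega>)"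
    proof (rule continuous_on_compose2[where g="\<lambda>u. \<Sum>n. coef n (\<gamma> u) * \<xi> n \<omega>"])
      show "continuous_on {0..1} (\<lambda>u. \<Sum>n. coef n (\<gamma> u) * \<xi> n \<omega>)" using elim by blast
      show "continuous_on {a..b} clock"
        unfolding clock_def using R by (intro continuous_intros cont) auto
    qed (use clock in auto)
    then have "continuous_on {a..b} (\<lambda>t. X t \<omega>)"
      by (rule continuous_on_cong[THEN iffD1, rotated 2]) (auto simp: reparam)
    moreover have "summable (\<lambda>n. coef n t * \<xi> n \<omega>)" if "t \<in> {a..b}" for t
      using elim clock[OF that] reparam[OF that] by fastforce
    ultimately show ?case by blast
  qed
qed

lemma almost_sure_summable: "t \<in> {a..b} \<Longrightarrow> AE \<omega> in M. summable (\<lambda>n. coef n t * \<xi> n \<omega>)"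
  using almost_all_paths by eventually_elim auto

lemma L2_convergence:
  assumes "t \<in> {a..b}"
  shows "L2_tendsto M (\<lambda>N \<omega>. \<Sum>n<N. coef n t * \<xi> n \<omega>) (X t)"
  using series_L2_tendsto[OF _ almost_sure_summable[OF assms]] increment_sums[of a t] ab assms
  by (simp add: coef_left)

text \<open>
  One statement serves twice: with a single interval it is the law of an increment, and with
  arbitrary weights it is the joint characteristic function needed for independence.
\<close>

lemma distr_combination:
  assumes I: "finite I" and st: "\<And>i. i \<in> I \<Longrightarrow> a \<le> s i \<and> s i \<le> t i \<and> t i \<le> b"
    and disj: "\<And>i j. i \<in> I \<Longrightarrow> j \<in> I \<Longrightarrow> i \<noteq> j \<Longrightarrow> {s i<..t i} \<inter> {s j<..t j} = {}"
  shows "distr M borel (\<lambda>\<omega>. \<Sum>i\<in>I. u i * (X (t i) \<omega> - X (s i) \<omega>))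
    = normal_law 0 (\<Sum>i\<in>I. (u i)\<^sup>2 * (\<rho> (t i) - \<rho> (s i)))"
proof -
  let ?d = "\<lambda>n. \<Sum>i\<in>I. u i * (coef n (t i) - coef n (s i))"
  have sums: "(\<lambda>n. ?d n * \<xi> n \<omega>) sums (\<Sum>i\<in>I. u i * (X (t i) \<omega> - X (s i) \<omega>))"
    if conv: "\<forall>t\<in>{a..b}. summable (\<lambda>n. coef n t * \<xi> n \<omega>)" for \<omega>
  proof -
    have *: "summable (\<lambda>n. coef n (t i) * \<xi> n \<omega>)" "summable (\<lambda>n. coef n (s i) * \<xi> n \<omega>)" if "i \<in> I" for i
      using conv st[OF that] by (auto dest: order_trans)
    have "(\<lambda>n. \<Sum>i\<in>I. u i * (coef n (t i) * \<xi> n \<omega> - coef n (s i) * \<xi> n \<omega>)) sums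
        (\<Sum>i\<in>I. u i * (X (t i) \<omega> - X (s i) \<omega>))"
      by (intro sums_sum sums_mult sums_diff summable_sums *)
    also have "(\<lambda>n. \<Sum>i\<in>I. u i * (coef n (t i) * \<xi> n \<omega> - coef n (s i) * \<xi> n \<omega>)) = (\<lambda>n. ?d n * \<xi> n \<omega>)"
      by (simp add: sum_distrib_right mult.assoc left_diff_distrib)
    finally show ?thesis .
  qed
  have AE: "AE \<omega> in M. (\<lambda>n. ?d n * \<xi> n \<omega>) sums (\<Sum>i\<in>I. u i * (X (t i) \<omega> - X (s i) \<omega>))"
    using almost_all_paths by eventually_elim (use sums in blast)
  have "distr M borel (\<lambda>\<omega>. \<Sum>i\<in>I. u i * (X (t i) \<omega> - X (s i) \<omega>)) = distr M borel (\<lambda>\<omega>. \<Sum>n. ?d n * \<xi> n \<omega>)"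
  proof (rule distr_cong_AE[OF refl])
    show "AE \<omega> in M. (\<Sum>i\<in>I. u i * (X (t i) \<omega> - X (s i) \<omega>)) = (\<Sum>n. ?d n * \<xi> n \<omega>)"
      using AE by eventually_elim (rule sums_unique)
  qed auto
  also have "\<dots> = normal_law 0 (\<Sum>i\<in>I. (u i)\<^sup>2 * (\<rho> (t i) - \<rho> (s i)))"
  proof (rule distr_series[OF combination_sums[OF I st disj]])
    show "AE \<omega> in M. summable (\<lambda>n. ?d n * \<xi> n \<omega>)"
      using AE by eventually_elim (rule sums_summable)
  qed
  finally show ?thesis .
qed

lemma distr_increment:
  assumes "a \<le> s" "s \<le> t" "t \<le> b"
  shows "distr M borel (\<lambda>\<omega>. X t \<omega> - X s \<omega>) = normal_law 0 (\<rho> t - \<rho> s)"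
  using distr_combination[of "{()}" "\<lambda>_. s" "\<lambda>_. t" "\<lambda>_. 1"] assms by simp

lemma independent_increments_X: "independent_increments M a b X"
  unfolding independent_increments_def
proof (intro allI impI, elim conjE)
  fix n :: nat and \<tau> :: "nat \<Rightarrow> real"
  assume dom: "\<forall>i\<le>n. \<tau> i \<in> {a..b}" and inc: "\<forall>i<n. \<tau> i < \<tau> (Suc i)"
  let ?Y = "\<lambda>i \<omega>. X (\<tau> (Suc i)) \<omega> - X (\<tau> i) \<omega>"
  have le: "\<tau> i \<le> \<tau> j" if "i \<le> j" "j \<le> n" for i j
    using that
  proof (induction j rule: dec_induct)
    case (step j)
    then have "\<tau> j < \<tau> (Suc j)" using inc by simp
    then show ?case using step by simp
  qed simp
  have st: "a \<le> \<tau> i \<and> \<tau> i \<le> \<tau> (Suc i) \<and> \<tau> (Suc i) \<le> b" if "i \<in> {..<n}" for i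
    using dom le[of i "Suc i"] that by (auto simp: Suc_le_eq)
  have disj: "{\<tau> i<..\<tau> (Suc i)} \<inter> {\<tau> j<..\<tau> (Suc j)} = {}" if "i \<in> {..<n}" "j \<in> {..<n}" "i \<noteq> j" for i j
    using le[of "Suc i" j] le[of "Suc j" i] that by (cases "i < j") auto
  show "indep_vars (\<lambda>_. borel) ?Y {..<n}"
  proof (rule indep_vars_char)
    fix u :: "nat \<Rightarrow> real"
    let ?v = "\<Sum>i<n. (u i)\<^sup>2 * (\<rho> (\<tau> (Suc i)) - \<rho> (\<tau> i))"
    have nonneg: "0 \<le> \<rho> (\<tau> (Suc i)) - \<rho> (\<tau> i)" if "i \<in> {..<n}" for i
      using rho_mono st[OF that] by simp
    have v: "0 \<le> ?v" using nonneg by (intro sum_nonneg) auto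
    have "(CLINT \<omega>|M. iexp (\<Sum>i<n. u i * ?Y i \<omega>)) = char (distr M borel (\<lambda>\<omega>. \<Sum>i<n. u i * ?Y i \<omega>)) 1"
      unfolding char_def by (subst integral_distr) auto
    also have "\<dots> = complex_of_real (exp (- ?v / 2))"
      using v distr_combination[where s=\<tau> and t="\<lambda>i. \<tau> (Suc i)" and u=u, OF finite_lessThan st disj]
      by (simp add: char_normal_law)
    also have "\<dots> = (\<Prod>i<n. complex_of_real (exp (- ((u i)\<^sup>2 * (\<rho> (\<tau> (Suc i)) - \<rho> (\<tau> i))) / 2)))"
      by (simp only: of_real_prod[symmetric] exp_sum[OF finite_lessThan, symmetric]
          sum_divide_distrib[symmetric] sum_negf)
    also have "\<dots> = (\<Prod>i<n. char (distr M borel (?Y i)) (u i))"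
    proof (rule prod.cong[OF refl])
      fix i assume i: "i \<in> {..<n}"
      have "char (distr M borel (?Y i)) (u i) = exp (- (\<rho> (\<tau> (Suc i)) - \<rho> (\<tau> i)) * (u i)\<^sup>2 / 2)"
        using st[OF i] nonneg[OF i] by (subst distr_increment) (auto simp: char_normal_law)
      then show "complex_of_real (exp (- ((u i)\<^sup>2 * (\<rho> (\<tau> (Suc i)) - \<rho> (\<tau> i))) / 2)) = char (distr M borel (?Y i)) (u i)"
        by (simp add: algebra_simps)
    qed
    finally show "(CLINT \<omega>|M. iexp (\<Sum>i<n. u i * ?Y i \<omega>)) = (\<Prod>i<n. char (distr M borel (?Y i)) (u i))" .
  qed auto
qed

lemma yeh_process_shifted:
  assumes m: "continuous_on {a..b} m"
  shows "yeh_process M a b m \<rho> (\<lambda>t \<omega>. m t + X t \<omega>)"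
  unfolding yeh_process_def
proof (intro conjI ballI allI impI)
  show "(\<lambda>\<omega>. m t + X t \<omega>) \<in> borel_measurable M" for t by measurable
  show "AE \<omega> in M. continuous_on {a..b} (\<lambda>t. m t + X t \<omega>)"
    using almost_all_paths by eventually_elim (intro continuous_on_add m, blast)
  show "independent_increments M a b (\<lambda>t \<omega>. m t + X t \<omega>)"
    unfolding independent_increments_def
  proof (intro allI impI)
    fix n :: nat and \<tau> :: "nat \<Rightarrow> real"
    assume "(\<forall>i\<le>n. \<tau> i \<in> {a..b}) \<and> (\<forall>i<n. \<tau> i < \<tau> (Suc i))"
    then have "indep_vars (\<lambda>_. borel) (\<lambda>i \<omega>. X (\<tau> (Suc i)) \<omega> - X (\<tau> i) \<omega>) {..<n}"
      using independent_increments_X by (auto simp: independent_increments_def)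
    then have "indep_vars (\<lambda>_. borel) (\<lambda>i \<omega>. (m (\<tau> (Suc i)) - m (\<tau> i)) + (X (\<tau> (Suc i)) \<omega> - X (\<tau> i) \<omega>)) {..<n}"
      by (rule indep_vars_compose2) auto
    then show "indep_vars (\<lambda>_. borel) (\<lambda>i \<omega>. m (\<tau> (Suc i)) + X (\<tau> (Suc i)) \<omega> - (m (\<tau> i) + X (\<tau> i) \<omega>)) {..<n}"
      by (simp add: algebra_simps)
  qed
  fix s t assume st: "a \<le> s \<and> s < t \<and> t \<le> b"
  then have v: "0 \<le> \<rho> t - \<rho> s" using rho_mono[of s t] by simp
  let ?c = "m t - m s"
  have "distr M borel (\<lambda>\<omega>. m t + X t \<omega> - (m s + X s \<omega>))
      = distr (distr M borel (\<lambda>\<omega>. X t \<omega> - X s \<omega>)) borel (\<lambda>x. ?c + x)"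
    by (subst distr_distr) (auto simp: comp_def algebra_simps)
  also have "\<dots> = distr (normal_law 0 (\<rho> t - \<rho> s)) borel (\<lambda>x. ?c + x)"
    using st by (subst distr_increment) auto
  also have "\<dots> = normal_law ?c (\<rho> t - \<rho> s)"
    unfolding normal_law_eq_distr[OF v] by (subst distr_distr) (auto simp: comp_def)
  finally show "distr M borel (\<lambda>\<omega>. m t + X t \<omega> - (m s + X s \<omega>)) = normal_law ?c (\<rho> t - \<rho> s)" .
qed

end

theorem mainTheorem7:
  fixes a b :: real
    and \<rho> :: "real \<Rightarrow> real"
    and \<phi> :: "nat \<Rightarrow> real \<Rightarrow> real"
    and M :: "'w measure"
    and \<xi> :: "nat \<Rightarrow> 'w \<Rightarrow> real"
  assumes "0 \<le> a" and "a < b"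
    and "continuous_on {a..b} \<rho>"
    and "mono_on {a..b} \<rho>"
    and "equivalent_measures (stieltjes_measure a b \<rho>) (lebesgue_on {a..b})"
    and "L2_orthonormal_basis (stieltjes_measure a b \<rho>) \<phi>"
    and "prob_space M"
    and "prob_space.indep_vars M (\<lambda>_. borel) \<xi> UNIV"
    and "\<And>n. distributed M lborel (\<xi> n) std_normal_density"
  shows
    "(\<forall>t\<in>{a..b}.
        L2_tendsto M (\<lambda>N \<omega>. \<Sum>n<N. stieltjes_primitive a b \<rho> (\<phi> n) t * \<xi> n \<omega>)
                     (\<lambda>\<omega>. \<Sum>n. stieltjes_primitive a b \<rho> (\<phi> n) t * \<xi> n \<omega>)) \<and>
     (AE \<omega> in M. \<forall>t\<in>{a..b}. summable (\<lambda>n. stieltjes_primitive a b \<rho> (\<phi> n) t * \<xi> n \<omega>)) \<and>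
     yeh_process M a b (\<lambda>_. 0) \<rho>
       (\<lambda>t \<omega>. \<Sum>n. stieltjes_primitive a b \<rho> (\<phi> n) t * \<xi> n \<omega>) \<and>
     (\<forall>m. continuous_on {a..b} m \<and> bounded_variation_on a b m \<longrightarrow>
        yeh_process M a b m \<rho>
          (\<lambda>t \<omega>. m t + (\<Sum>n. stieltjes_primitive a b \<rho> (\<phi> n) t * \<xi> n \<omega>)))"
proof -
  interpret prob_space M by fact
  interpret gaussian_stieltjes_series M \<xi> a b \<rho> \<phi>
    by unfold_locales fact+
  have "AE \<omega> in M. \<forall>t\<in>{a..b}. summable (\<lambda>n. coef n t * \<xi> n \<omega>)"
    using almost_all_paths by eventually_elim blast
  moreover have "yeh_process M a b (\<lambda>_. 0) \<rho> X"
    using yeh_process_shifted[of "\<lambda>_. 0"] by simp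
  ultimately show ?thesis
    using L2_convergence yeh_process_shifted by blast
qed

end
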